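(* Consider the semi-discrete model in dimension $d=1$ with driving force $F=0.9$, $$\dot u_i(t,\omega)=\Delta_1 u_i(t,\omega)-f_i(u_i(t,\omega),\omega)+F,\qquad u_i(0)=0,\qquad i\in\mathbf{Z},\ t\ge0,$$ where the obstacle forces $f_i$ are the piecewise affine functions described in the context, depending on a parameter $\delta\in(0,\frac12)$ and on an obstacle field $Q_{i,j}$ built from independent copies, one for each row $j\in\mathbf{N}_0$, of a stationary discrete renewal point process with gap distribution $G$. There exist a distribution $G$ of an $\mathbf{N}$-valued random variable with finite mean and a sufficiently small $\delta>0$ such that, almost surely, there is no non-negative stationary solution (i.e. no $w:\mathbf{Z}\to[0,\infty)$ with $\Delta_1 w_i-f_i(w_i)+F=0$ for all $i\in\mathbf{Z}$), $\lim_{t\to\infty}u_i(t)=+\infty$ for every $i\in\mathbf{Z}$, and yet $$\limsup_{t\to\infty}\frac{u_0(t)}{t}=0 .$$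
   Context: $\mathbf{N}=\{1,2,\dots\}$, $\mathbf{N}_0=\{0,1,2,\dots\}$. The one-dimensional discrete Laplacian is $\Delta_1 u_i=u_{i+1}+u_{i-1}-2u_i$. The solution $u$ is the unique one among those with $\sup_i\sup_{s\le t}|u_i(s)|<\infty$ for every $t$. Obstacle field: a stationary discrete renewal point process with gap distribution $G$ is a random subset of $\mathbf{Z}$ whose law is invariant under integer shifts and for which, conditionally on $0$ being a point, the successive gaps between consecutive points are independent with law $G$ (it exists when $G$ has finite mean). For each row $j\in\mathbf{N}_0$ an independent copy of this process is taken; $Q_{i,j}=0$ if $i$ is a point of the process in row $j$, and $Q_{i,j}=1$ otherwise. Obstacle forces: $f_i(y)=\sum_{j=0}^\infty Q_{i,j}\,\phi_\delta(y-(j+1))$ for $y\in\mathbf{R}$, where $\phi_\delta(z)=\max\{0,1-|z|/\delta\}$ is the piecewise affine hat function with $\phi_\delta(0)=1$ supported in $[-\delta,\delta]$; thus $f_i(j+1)=Q_{i,j}$. *)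

theory Defs
  imports "HOL-Probability.Probability"
begin

text \<open>A subset of the integers is represented by its indicator \<open>\<eta> :: int \<Rightarrow> bool\<close>, and the law of a
  random subset by a measure on the product sigma-algebra.\<close>

abbreviation config_algebra :: "(int \<Rightarrow> bool) measure" where
  "config_algebra \<equiv> PiM UNIV (\<lambda>_. count_space UNIV)"

definition next_point :: "(int \<Rightarrow> bool) \<Rightarrow> int \<Rightarrow> int" where
  "next_point \<eta> x = x + int (LEAST n. 0 < n \<and> \<eta> (x + int n))"

definition prev_point :: "(int \<Rightarrow> bool) \<Rightarrow> int \<Rightarrow> int" where
  "prev_point \<eta> x = x - int (LEAST n. 0 < n \<and> \<eta> (x - int n))"

text \<open>If \<open>\<eta>\<close> contains 0 and is unbounded in both directions, the following is the increasing
  enumeration of \<open>\<eta>\<close> that maps 0 to 0; \<open>gap k\<close> is then the distance between the points number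
  \<open>k\<close> and \<open>k + 1\<close>. Elsewhere the values are irrelevant.\<close>

definition nth_point :: "(int \<Rightarrow> bool) \<Rightarrow> int \<Rightarrow> int" where
  "nth_point \<eta> k =
     (if 0 \<le> k then (next_point \<eta> ^^ nat k) 0 else (prev_point \<eta> ^^ nat (- k)) 0)"

definition gap :: "int \<Rightarrow> (int \<Rightarrow> bool) \<Rightarrow> nat" where
  "gap k \<eta> = nat (nth_point \<eta> (k + 1) - nth_point \<eta> k)"

text \<open>Conditioning on the event that 0 is a point is expressed by \<^const>\<open>uniform_measure\<close>. The
  requirement that the random set be almost surely nonempty excludes mixtures of a stationary
  renewal process with the empty set, which satisfy the other conditions.\<close>

definition stationary_renewal_law :: "nat pmf \<Rightarrow> (int \<Rightarrow> bool) measure \<Rightarrow> bool" where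
  "stationary_renewal_law G R \<longleftrightarrow>
     prob_space R \<and>
     sets R = sets config_algebra \<and>
     (AE \<eta> in R. \<exists>i. \<eta> i) \<and>
     (\<forall>m. distr R R (\<lambda>\<eta> i. \<eta> (i + m)) = R) \<and>
     (let R0 = uniform_measure R {\<eta>. \<eta> 0} in
        prob_space.indep_vars R0 (\<lambda>_. count_space UNIV) gap UNIV \<and>
        (\<forall>k. distr R0 (count_space UNIV) (gap k) = measure_pmf G))"

text \<open>An environment \<open>\<omega> :: nat \<Rightarrow> int \<Rightarrow> bool\<close> gives for each row \<open>j\<close> the set \<open>\<omega> j\<close> of sites
  without obstacle.\<close>

definition obstacle_field_law :: "(int \<Rightarrow> bool) measure \<Rightarrow> (nat \<Rightarrow> int \<Rightarrow> bool) measure" where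
  "obstacle_field_law R = PiM UNIV (\<lambda>_. R)"

definition Q :: "(nat \<Rightarrow> int \<Rightarrow> bool) \<Rightarrow> int \<Rightarrow> nat \<Rightarrow> real" where
  "Q \<omega> i j = (if \<omega> j i then 0 else 1)"

definition hat :: "real \<Rightarrow> real \<Rightarrow> real" where
  "hat \<delta> z = max 0 (1 - \<bar>z\<bar> / \<delta>)"

definition obstacle_force :: "real \<Rightarrow> (nat \<Rightarrow> int \<Rightarrow> bool) \<Rightarrow> int \<Rightarrow> real \<Rightarrow> real" where
  "obstacle_force \<delta> \<omega> i y = (\<Sum>j. Q \<omega> i j * hat \<delta> (y - (real j + 1)))"

definition laplacian :: "(int \<Rightarrow> real) \<Rightarrow> int \<Rightarrow> real" where
  "laplacian v i = v (i + 1) + v (i - 1) - 2 * v i"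

definition rhs ::
  "real \<Rightarrow> real \<Rightarrow> (nat \<Rightarrow> int \<Rightarrow> bool) \<Rightarrow> (int \<Rightarrow> real) \<Rightarrow> int \<Rightarrow> real" where
  "rhs F \<delta> \<omega> v i = laplacian v i - obstacle_force \<delta> \<omega> i (v i) + F"

text \<open>Solutions are only constrained on \<open>t \<ge> 0\<close>; the derivative at 0 is one-sided.\<close>

definition evolution_solution ::
  "real \<Rightarrow> real \<Rightarrow> (nat \<Rightarrow> int \<Rightarrow> bool) \<Rightarrow> (int \<Rightarrow> real \<Rightarrow> real) \<Rightarrow> bool" where
  "evolution_solution F \<delta> \<omega> u \<longleftrightarrow>
     (\<forall>i. u i 0 = 0) \<and>
     (\<forall>i. \<forall>t\<ge>0. (u i has_real_derivative rhs F \<delta> \<omega> (\<lambda>k. u k t) i) (at t within {0..})) \<and>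
     (\<forall>t\<ge>0. bdd_above {\<bar>u i s\<bar> | i s. 0 \<le> s \<and> s \<le> t})"

definition nonneg_stationary_solution ::
  "real \<Rightarrow> real \<Rightarrow> (nat \<Rightarrow> int \<Rightarrow> bool) \<Rightarrow> (int \<Rightarrow> real) \<Rightarrow> bool" where
  "nonneg_stationary_solution F \<delta> \<omega> w \<longleftrightarrow> (\<forall>i. 0 \<le> w i) \<and> (\<forall>i. rhs F \<delta> \<omega> w i = 0)"

end

theory Submission
  imports Defs
begin

text \<open>At a site where no obstacle acts, the
  curvature of a stationary profile is \<open>-F\<close>, at an obstacle it is at most \<open>1 - F\<close>. When the hats are
  narrow, consecutive sites held by obstacles lie on a straight line of integer slope, so an
  interval of such sites can gain slope only at its two ends, at most \<open>2 * (1 - F) + 4 * \<delta>\<close> in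
  total, however long it is. For \<open>F = 0.9\<close> this is less than the slope \<open>F\<close> lost at the
  free site before it. A profile with infinitely many free sites to the right therefore bends down
  and becomes negative, and the only candidates left have a whole ray of obstacles along a line of
  integer slope (lemma \<open>stationary_imp_obstacle_ray\<close>). There are countably many rays, and each is
  almost surely interrupted: a horizontal one because a stationary renewal set is unbounded, a
  sloped one because its obstacles are in distinct, independent rows. Hence almost surely there is
  no non-negative stationary solution.

  The comparison principle shows that the interface is non-negative and increases in time. If it
  stayed bounded at one site, it would be bounded at every site and converge to a non-negative
  stationary solution, so it tends to infinity everywhere.

  The zero velocity comes from the size-biasing of gaps. An obstacle-free site reaches
  its neighbours only at a finite speed: if row \<open>j\<close> has no gap within distance \<open>L\<close> of the origin, an
  explicit supersolution keeps the interface at the origin below \<open>j + 2\<close> up to a time proportional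
  to \<open>L\<close> (lemma \<open>pinned_up_to_crossing_time\<close>). The probability of such a run is of
  the order of the tail \<open>\<Sum>n>L. P(gap > n)\<close>, which decays slowly when the gap has a finite mean but a
  very heavy tail. With the distribution chosen here some row below \<open>2^k\<close> has a run of
  length \<open>4^k\<close>, for all large \<open>k\<close>, almost surely; so \<open>u 0 t = O(sqrt t)\<close>.

  It remains to construct the objects. The evolution is a differential equation with
  Lipschitz right-hand side on bounded sequences. The stationary renewal process is
  obtained from independent gaps by Palm inversion: the point process seen from a point is averaged
  over all sites of the gap that starts at that point.\<close>

section \<open>The obstacle force\<close>

lemma hat_nonneg: "0 \<le> hat \<delta> z"
  by (simp add: hat_def)

lemma hat_le_1: "0 < \<delta> \<Longrightarrow> hat \<delta> z \<le> 1"
  by (simp add: hat_def)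

lemma hat_eq_0: "0 < \<delta> \<Longrightarrow> \<delta> \<le> \<bar>z\<bar> \<Longrightarrow> hat \<delta> z = 0"
  by (simp add: hat_def field_simps max_def)

lemma hat_lipschitz:
  assumes "0 < \<delta>"
  shows "\<bar>hat \<delta> a - hat \<delta> b\<bar> \<le> \<bar>a - b\<bar> / \<delta>"
proof -
  have "\<bar>max 0 x - max 0 y\<bar> \<le> \<bar>x - y\<bar>" for x y :: real by linarith
  then have "\<bar>hat \<delta> a - hat \<delta> b\<bar> \<le> \<bar>(1 - \<bar>a\<bar> / \<delta>) - (1 - \<bar>b\<bar> / \<delta>)\<bar>"
    unfolding hat_def by blast
  also have "\<dots> = \<bar>\<bar>b\<bar> - \<bar>a\<bar>\<bar> / \<delta>"
    using assms by (simp add: abs_divide flip: diff_divide_distrib)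
  also have "\<dots> \<le> \<bar>a - b\<bar> / \<delta>"
    using assms by (intro divide_right_mono) auto
  finally show ?thesis .
qed

lemma nat_row_distance:
  assumes "k \<noteq> j"
  shows "1 \<le> \<bar>real k - real j\<bar>"
proof -
  have "1 \<le> \<bar>int k - int j\<bar>" using assms by linarith
  then have "1 \<le> real_of_int \<bar>int k - int j\<bar>" by (simp only: of_int_1_le_iff)
  then show ?thesis by simp
qed

lemma obstacle_force_near_row:
  assumes "0 < \<delta>" "\<bar>y - (real j + 1)\<bar> \<le> 1 - \<delta>"
  shows "obstacle_force \<delta> \<omega> i y = Q \<omega> i j * hat \<delta> (y - (real j + 1))"
proof -
  have "Q \<omega> i k * hat \<delta> (y - (real k + 1)) = 0" if "k \<notin> {j}" for k
  proof -
    have "1 \<le> \<bar>real k - real j\<bar>" using that nat_row_distance by auto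
    then have "\<delta> \<le> \<bar>y - (real k + 1)\<bar>" using assms(2) by linarith
    then show ?thesis using assms(1) by (simp add: hat_eq_0)
  qed
  then have "(\<Sum>k. Q \<omega> i k * hat \<delta> (y - (real k + 1)))
      = (\<Sum>k\<in>{j}. Q \<omega> i k * hat \<delta> (y - (real k + 1)))"
    by (intro suminf_finite) auto
  then show ?thesis by (simp add: obstacle_force_def)
qed

lemma obstacle_force_away:
  assumes "0 < \<delta>" "\<And>j. \<delta> \<le> \<bar>y - (real j + 1)\<bar>"
  shows "obstacle_force \<delta> \<omega> i y = 0"
  using assms by (simp add: obstacle_force_def hat_eq_0)

lemma obstacle_force_bounds:
  assumes "0 < \<delta>" "\<delta> \<le> 1 / 2"
  shows "0 \<le> obstacle_force \<delta> \<omega> i y" "obstacle_force \<delta> \<omega> i y \<le> 1"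
proof -
  have "0 \<le> obstacle_force \<delta> \<omega> i y \<and> obstacle_force \<delta> \<omega> i y \<le> 1"
  proof (cases "\<exists>j. \<bar>y - (real j + 1)\<bar> < \<delta>")
    case True
    then obtain j where "\<bar>y - (real j + 1)\<bar> < \<delta>" by blast
    then have "obstacle_force \<delta> \<omega> i y = Q \<omega> i j * hat \<delta> (y - (real j + 1))"
      using assms by (intro obstacle_force_near_row) auto
    then show ?thesis using hat_nonneg hat_le_1 assms by (simp add: Q_def)
  next
    case False
    then show ?thesis using assms by (subst (1 2) obstacle_force_away) (auto simp: not_less)
  qed
  then show "0 \<le> obstacle_force \<delta> \<omega> i y" "obstacle_force \<delta> \<omega> i y \<le> 1" by auto
qed

lemma obstacle_force_nonzero:
  assumes "0 < \<delta>" "\<delta> \<le> 1 / 2" "obstacle_force \<delta> \<omega> i y \<noteq> 0"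
  obtains j where "\<not> \<omega> j i" "\<bar>y - (real j + 1)\<bar> < \<delta>"
proof -
  obtain j where j: "\<bar>y - (real j + 1)\<bar> < \<delta>"
    using assms obstacle_force_away[of \<delta> y] by (meson not_less)
  then have "obstacle_force \<delta> \<omega> i y = Q \<omega> i j * hat \<delta> (y - (real j + 1))"
    using assms by (intro obstacle_force_near_row) auto
  then have "\<not> \<omega> j i" using assms(3) by (auto simp: Q_def)
  with j show ?thesis using that by blast
qed

lemma obstacle_force_lipschitz:
  assumes "0 < \<delta>" "\<delta> \<le> 1 / 3"
  shows "\<bar>obstacle_force \<delta> \<omega> i a - obstacle_force \<delta> \<omega> i b\<bar> \<le> \<bar>a - b\<bar> / \<delta>"
proof -
  have aux: "\<bar>obstacle_force \<delta> \<omega> i a - obstacle_force \<delta> \<omega> i b\<bar> \<le> \<bar>a - b\<bar> / \<delta>"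
    if "\<bar>a - b\<bar> < \<delta>" "\<bar>a - (real j + 1)\<bar> < \<delta>" for a b j
  proof -
    have "obstacle_force \<delta> \<omega> i c = Q \<omega> i j * hat \<delta> (c - (real j + 1))" if "c = a \<or> c = b" for c
      using assms that \<open>\<bar>a - b\<bar> < \<delta>\<close> \<open>\<bar>a - (real j + 1)\<bar> < \<delta>\<close>
      by (intro obstacle_force_near_row) auto
    moreover have "\<bar>Q \<omega> i j\<bar> \<le> 1" by (simp add: Q_def)
    ultimately have "\<bar>obstacle_force \<delta> \<omega> i a - obstacle_force \<delta> \<omega> i b\<bar>
        \<le> \<bar>hat \<delta> (a - (real j + 1)) - hat \<delta> (b - (real j + 1))\<bar>"
      by (simp add: Q_def)
    also have "\<dots> \<le> \<bar>a - b\<bar> / \<delta>"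
      using hat_lipschitz[OF assms(1), of "a - (real j + 1)" "b - (real j + 1)"] by simp
    finally show ?thesis .
  qed
  show ?thesis
  proof (cases "\<bar>a - b\<bar> < \<delta>")
    case True
    consider j where "\<bar>a - (real j + 1)\<bar> < \<delta>" | j where "\<bar>b - (real j + 1)\<bar> < \<delta>"
      | "\<And>j. \<delta> \<le> \<bar>a - (real j + 1)\<bar>" "\<And>j. \<delta> \<le> \<bar>b - (real j + 1)\<bar>"
      by (meson not_less)
    then show ?thesis
    proof cases
      case 1
      then show ?thesis using aux True by blast
    next
      case 2
      then show ?thesis using aux[of b a] True by (simp add: abs_minus_commute)
    next
      case 3
      then show ?thesis using assms by (simp add: obstacle_force_away)
    qed
  next
    case False
    have "\<bar>obstacle_force \<delta> \<omega> i a - obstacle_force \<delta> \<omega> i b\<bar> \<le> 1"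
      using obstacle_force_bounds[of \<delta> \<omega> i a] obstacle_force_bounds[of \<delta> \<omega> i b] assms by auto
    also have "1 \<le> \<bar>a - b\<bar> / \<delta>" using False assms by (simp add: field_simps)
    finally show ?thesis .
  qed
qed

section \<open>Stationary solutions are straight obstacle rays\<close>

definition obstacle_ray :: "(nat \<Rightarrow> int \<Rightarrow> bool) \<Rightarrow> int \<Rightarrow> nat \<Rightarrow> nat \<Rightarrow> bool" where
  "obstacle_ray \<omega> N j m \<longleftrightarrow> (\<forall>l::nat. \<not> \<omega> (j + m * l) (N + int l))"

lemma slopes_eventually_le_imp_negative:
  fixes x :: "nat \<Rightarrow> real"
  assumes "\<And>l. i \<le> l \<Longrightarrow> x (Suc l) - x l \<le> - 1"
  shows "\<exists>l. x l < 0"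
proof -
  have "x (i + n) \<le> x i - real n" for n
  proof (induction n)
    case (Suc n)
    then show ?case using assms[of "i + n"] by simp
  qed simp
  moreover obtain n where "x i < real n" using reals_Archimedean2 by blast
  ultimately have "x (i + n) < 0" by (smt (verit))
  then show ?thesis by blast
qed

text \<open>Once two neighbouring sites are held by obstacles, the height at the next site is determined up
  to an error below 1, because the curvature lies in an interval of length 1 that the narrow hats
  widen only slightly. If that site is held too, its row is therefore the one on the line through
  the first two. Along an interval of held sites the slope is thus constant up to \<open>4 * \<delta>\<close> except
  at the two ends, where it gains at most \<open>1 - F\<close> each. The next free site takes away \<open>F\<close>, which
  is more. So either the free sites on the right come to an end, or the slope tends to
  \<open>-\<infinity>\<close>.\<close>

lemma stationary_imp_obstacle_ray:
  assumes \<delta>: "0 < \<delta>" and flat: "F + 4 * \<delta> < 1" and concave: "2 + 4 * \<delta> < 3 * F"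
    and w: "nonneg_stationary_solution F \<delta> \<omega> w"
  shows "\<exists>N j m. obstacle_ray \<omega> N j m"
proof -
  have \<delta>2: "\<delta> \<le> 1 / 2" using \<delta> flat concave by linarith
  have F: "0 < F" "F < 1" using \<delta> flat concave by auto
  define x where "x n = w (int n)" for n
  define s where "s n = x (Suc n) - x n" for n
  define f where "f n = obstacle_force \<delta> \<omega> (int n) (x n)" for n
  define pinned where "pinned n \<longleftrightarrow> f n \<noteq> 0" for n
  have x_nonneg: "0 \<le> x n" for n
    using w by (simp add: x_def nonneg_stationary_solution_def)
  have curv: "s (Suc n) = s n + f (Suc n) - F" for n
  proof -
    have "rhs F \<delta> \<omega> w (int (Suc n)) = 0" using w unfolding nonneg_stationary_solution_def by blast
    then show ?thesis
      by (simp add: rhs_def laplacian_def s_def x_def f_def algebra_simps)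
  qed
  have f_le: "f n \<le> 1" for n using obstacle_force_bounds \<delta> \<delta>2 by (simp add: f_def)
  have f_ge: "0 \<le> f n" for n using obstacle_force_bounds \<delta> \<delta>2 by (simp add: f_def)
  obtain row where row: "\<And>n. pinned n \<Longrightarrow> \<not> \<omega> (row n) (int n)"
      "\<And>n. pinned n \<Longrightarrow> \<bar>x n - (real (row n) + 1)\<bar> < \<delta>"
  proof -
    have "\<forall>n. \<exists>j. pinned n \<longrightarrow> \<not> \<omega> j (int n) \<and> \<bar>x n - (real j + 1)\<bar> < \<delta>"
      using obstacle_force_nonzero[OF \<delta> \<delta>2] unfolding pinned_def f_def by metis
    then show ?thesis using that by metis
  qed
  \<comment> \<open>the second difference of the rows is an integer of absolute value less than 1\<close>
  have collinear: "int (row (Suc (Suc n))) - int (row (Suc n)) = int (row (Suc n)) - int (row n)"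
    if "pinned n" "pinned (Suc n)" "pinned (Suc (Suc n))" for n
  proof -
    have "\<bar>real_of_int (int (row (Suc (Suc n))) - 2 * int (row (Suc n)) + int (row n))\<bar> < 1"
      using row(2)[OF that(1)] row(2)[OF that(2)] row(2)[OF that(3)] curv[of n]
        f_le[of "Suc n"] f_ge[of "Suc n"] flat F concave unfolding s_def by (simp add: abs_if split: if_splits)
    then have "int (row (Suc (Suc n))) - 2 * int (row (Suc n)) + int (row n) = 0" by linarith
    then show ?thesis by simp
  qed
  have straight: "int (row (Suc (i + n))) - int (row (i + n)) = int (row (Suc i)) - int (row i)"
    if "\<And>l. i \<le> l \<Longrightarrow> l \<le> Suc (i + n) \<Longrightarrow> pinned l" for i n
    using that
  proof (induction n)
    case (Suc n)
    then have "int (row (Suc (i + n))) - int (row (i + n)) = int (row (Suc i)) - int (row i)"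
      by simp
    moreover have "pinned (i + n)" "pinned (Suc (i + n))" "pinned (Suc (Suc (i + n)))"
      using Suc.prems by auto
    ultimately show ?case using collinear[of "i + n"] by simp
  qed simp
  have slope_gain: "s (i + n) \<le> s i + (2 - 2 * F) + 4 * \<delta>"
    if "\<And>l. i < l \<Longrightarrow> l \<le> i + n \<Longrightarrow> pinned l" for i n
  proof -
    consider "n = 0" | "n = 1" | k where "n = Suc (Suc k)"
      by (metis One_nat_def not0_implies_Suc)
    then show ?thesis
    proof cases
      case 1
      then show ?thesis using F \<delta> by simp
    next
      case 2
      then show ?thesis using curv[of i] f_le[of "Suc i"] F \<delta> by simp
    next
      case 3
      have "int (row (Suc (Suc i + k))) - int (row (Suc i + k)) = int (row (Suc (Suc i))) - int (row (Suc i))"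
        using that 3 by (intro straight) auto
      then have "real_of_int (int (row (Suc (Suc i + k))) - int (row (Suc i + k)))
          = real_of_int (int (row (Suc (Suc i))) - int (row (Suc i)))" by (simp only:)
      then have r: "real (row (Suc (Suc (i + k)))) - real (row (Suc (i + k))) = real (row (Suc (Suc i))) - real (row (Suc i))"
        by simp
      have p: "pinned (Suc i)" "pinned (Suc (Suc i))" "pinned (Suc (i + k))" "pinned (Suc (Suc (i + k)))"
        using that 3 by auto
      have "s (Suc (i + k)) - s (Suc i) \<le> 4 * \<delta>"
        using p[THEN row(2)] r unfolding s_def by (simp add: abs_if split: if_splits)
      then show ?thesis
        using 3 curv[of i] curv[of "Suc (i + k)"] f_le[of "Suc i"] f_le[of "Suc (Suc (i + k))"] by simp
    qed
  qed
  show ?thesis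
  proof (cases "\<exists>N. \<forall>n\<ge>N. pinned n")
    case True
    then obtain N where N: "\<And>n. N \<le> n \<Longrightarrow> pinned n" by blast
    define m where "m = int (row (Suc N)) - int (row N)"
    have line: "int (row (N + l)) = int (row N) + m * int l" for l
    proof (induction l)
      case (Suc l)
      have "int (row (Suc (N + l))) - int (row (N + l)) = m"
        unfolding m_def using N by (intro straight) auto
      then show ?case using Suc by (simp add: algebra_simps)
    qed simp
    \<comment> \<open>rows are indexed by natural numbers, so the line cannot descend for ever\<close>
    have "0 \<le> m"
    proof (rule ccontr)
      assume "\<not> 0 \<le> m"
      then have "m * int (row N + 1) \<le> (-1) * int (row N + 1)" by (intro mult_right_mono) auto
      then show False using line[of "row N + 1"] by simp
    qed
    then have "row (N + l) = row N + nat m * l" for l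
      using line[of l] by (metis int_nat_eq of_nat_add of_nat_eq_iff of_nat_mult)
    moreover have "\<not> \<omega> (row (N + l)) (int N + int l)" for l
      using row(1)[of "N + l"] N[of "N + l"] by simp
    ultimately have "obstacle_ray \<omega> (int N) (row N) (nat m)"
      by (simp add: obstacle_ray_def)
    then show ?thesis by blast
  next
    case False
    then have inf: "\<exists>k>i. \<not> pinned k" for i by (meson Suc_le_eq)
    define c where "c = 3 * F - 2 - 4 * \<delta>"
    have c: "0 < c" using concave by (simp add: c_def)
    have step: "\<exists>k>i. \<not> pinned k \<and> s k \<le> s i - c \<and> (\<forall>l. i \<le> l \<longrightarrow> l < k \<longrightarrow> s l \<le> s i + 1)" for i
    proof -
      define k where "k = (LEAST k. i < k \<and> \<not> pinned k)"
      have k: "i < k" "\<not> pinned k"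
        using LeastI_ex[OF inf[of i]] by (auto simp: k_def)
      have least: "pinned l" if "i < l" "l < k" for l
        using not_less_Least[of l "\<lambda>k. i < k \<and> \<not> pinned k"] that by (auto simp: k_def)
      have between: "s l \<le> s i + (2 - 2 * F) + 4 * \<delta>" if "i \<le> l" "l < k" for l
        using slope_gain[of i "l - i"] least that by simp
      obtain k' where k': "k = Suc k'" using k(1) by (cases k) auto
      have "s k = s k' - F" using curv[of k'] k(2) by (simp add: k' pinned_def)
      then have "s k \<le> s i - c" using between[of k'] k k' by (simp add: c_def)
      moreover have "2 - 2 * F + 4 * \<delta> \<le> 1" using concave F by linarith
      ultimately show ?thesis using k between by (intro exI[of _ k]) fastforce
    qed
    \<comment> \<open>each free site lowers the slope reached at the previous free site by at least \<open>c\<close>\<close>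
    have descend: "\<exists>k. s k \<le> s 0 - real n * c" for n
    proof (induction n)
      case (Suc n)
      then obtain i where "s i \<le> s 0 - real n * c" by blast
      moreover obtain k where "s k \<le> s i - c" using step[of i] by blast
      ultimately have "s k \<le> s 0 - real (Suc n) * c" by (simp add: algebra_simps)
      then show ?case by blast
    qed auto
    obtain n where "s 0 + 2 < real n * c" using c ex_less_of_nat_mult by blast
    moreover obtain i where "s i \<le> s 0 - real n * c" using descend[of n] by blast
    ultimately have i: "s i \<le> - 2" by linarith
    have "\<exists>k\<ge>i + n. s k \<le> - 2 \<and> (\<forall>l. i \<le> l \<longrightarrow> l < k \<longrightarrow> s l \<le> - 1)" for n
    proof (induction n)
      case 0
      show ?case using i by (intro exI[of _ i]) auto
    next
      case (Suc n)
      then obtain k where k: "k \<ge> i + n" "s k \<le> - 2" "\<And>l. i \<le> l \<Longrightarrow> l < k \<Longrightarrow> s l \<le> - 1" by blast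
      obtain k' where k': "k' > k" "s k' \<le> s k - c" "\<And>l. k \<le> l \<Longrightarrow> l < k' \<Longrightarrow> s l \<le> s k + 1"
        using step[of k] by blast
      have "s l \<le> -1" if "i \<le> l" "l < k'" for l
        using k(3)[OF that(1)] k'(3)[OF _ that(2)] k(2) by (cases "l < k") auto
      then show ?case using k k' c by (intro exI[of _ k']) auto
    qed
    then have "s l \<le> - 1" if "i \<le> l" for l
      using that by (metis Suc_le_eq le_add_diff_inverse add_Suc_right)
    then have "\<exists>l. x l < 0" by (intro slopes_eventually_le_imp_negative[of i]) (auto simp: s_def)
    then show ?thesis using x_nonneg by (meson not_less)
  qed
qed

section \<open>Comparison principle and divergence of the interface\<close>

text \<open>Multiplying by \<open>exp (- C * t - \<bar>i\<bar>)\<close> makes a bounded function on the infinite lattice small far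
  away, so that a positive supremum is attained. The spatial weight changes by at most the factor
  \<open>exp 1\<close> between neighbours, hence at the maximum the differential inequality with
  \<open>C > 2 * exp 1 + K\<close> forces the weighted function to decrease in time, which is impossible at a
  maximum that is attained at a positive time.\<close>

lemma discrete_maximum_principle:
  fixes d d' :: "int \<Rightarrow> real \<Rightarrow> real"
  assumes deriv: "\<And>i t. 0 \<le> t \<Longrightarrow> t \<le> T \<Longrightarrow> (d i has_real_derivative d' i t) (at t within {0..T})"
    and init: "\<And>i. d i 0 \<le> 0"
    and bound: "\<And>i t. 0 \<le> t \<Longrightarrow> t \<le> T \<Longrightarrow> d i t \<le> B"
    and growth: "\<And>i t. 0 \<le> t \<Longrightarrow> t \<le> T \<Longrightarrow> 0 < d i t \<Longrightarrow>
      d' i t \<le> max 0 (d (i + 1) t) + max 0 (d (i - 1) t) + K * d i t"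
    and "0 \<le> t" "t \<le> T"
  shows "d i t \<le> 0"
proof (rule ccontr)
  assume "\<not> d i t \<le> 0"
  define C where "C = 2 * exp 1 + K + 1"
  define g where "g k s = d k s * exp (- C * s - \<bar>real_of_int k\<bar>)" for k s
  \<comment> \<open>outside this finite set the weighted function cannot exceed the value \<open>g i t\<close>\<close>
  define I where "I = {k. g i t \<le> B * exp (\<bar>C\<bar> * T - \<bar>real_of_int k\<bar>)}"
  have pos: "0 < g i t" using \<open>\<not> d i t \<le> 0\<close> by (simp add: g_def)
  have "0 < d i t" using \<open>\<not> d i t \<le> 0\<close> by simp
  then have B: "0 < B" using bound[of t i] assms(5,6) by linarith
  have in_I: "k \<in> I" if "g i t \<le> g k s" "0 \<le> s" "s \<le> T" for k s
  proof -
    have "g k s \<le> B * exp (- C * s - \<bar>real_of_int k\<bar>)"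
      unfolding g_def using bound[OF that(2,3)] by (intro mult_right_mono) auto
    also have "\<dots> \<le> B * exp (\<bar>C\<bar> * T - \<bar>real_of_int k\<bar>)"
    proof -
      have "- C * s \<le> \<bar>C\<bar> * s" using that by (intro mult_right_mono) auto
      also have "\<dots> \<le> \<bar>C\<bar> * T" using that by (intro mult_left_mono) auto
      finally show ?thesis using B by simp
    qed
    finally show ?thesis using that by (simp add: I_def)
  qed
  have "finite I"
  proof -
    define M where "M = ln (B * exp (\<bar>C\<bar> * T) / g i t)"
    have "\<bar>real_of_int k\<bar> \<le> M" if "k \<in> I" for k
    proof -
      have "g i t * exp \<bar>real_of_int k\<bar> \<le> B * exp (\<bar>C\<bar> * T)"
        using that by (simp add: I_def exp_diff field_simps)
      then have "exp \<bar>real_of_int k\<bar> \<le> B * exp (\<bar>C\<bar> * T) / g i t"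
        using pos by (simp add: field_simps)
      then show ?thesis using B pos by (simp add: M_def ln_ge_iff)
    qed
    then have "\<bar>k\<bar> \<le> \<lceil>M\<rceil>" if "k \<in> I" for k
      using that le_of_int_ceiling[of M] by (metis ceiling_mono ceiling_of_int of_int_abs)
    then have "I \<subseteq> {- \<lceil>M\<rceil>..\<lceil>M\<rceil>}" by (fastforce simp: abs_le_iff)
    then show ?thesis using finite_subset by blast
  qed
  have i: "i \<in> I" using in_I[of i t] assms(5,6) by simp
  have cont: "continuous_on {0..T} (g k)" for k
  proof -
    have "continuous_on {0..T} (d k)"
      using deriv[of _ k] by (auto simp: continuous_on_eq_continuous_within intro!: DERIV_continuous)
    then show ?thesis unfolding g_def by (intro continuous_intros)
  qed
  have "\<exists>s\<in>{0..T}. \<forall>r\<in>{0..T}. g k r \<le> g k s" for k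
    using cont[of k] assms(5,6) by (intro continuous_attains_sup) auto
  then obtain top where top: "\<And>k. top k \<in> {0..T}" "\<And>k r. r \<in> {0..T} \<Longrightarrow> g k r \<le> g k (top k)"
    by metis
  have "Max ((\<lambda>k. g k (top k)) ` I) \<in> (\<lambda>k. g k (top k)) ` I"
    using \<open>finite I\<close> i by (intro Max_in) auto
  then obtain k where k: "k \<in> I" "Max ((\<lambda>k. g k (top k)) ` I) = g k (top k)" by auto
  have k: "k \<in> I" "\<And>l. l \<in> I \<Longrightarrow> g l (top l) \<le> g k (top k)"
    using \<open>finite I\<close> k by (auto simp flip: k(2))
  define s where "s = top k"
  have s: "0 \<le> s" "s \<le> T" using top(1)[of k] by (auto simp: s_def)
  have ge: "g i t \<le> g k s"
    using top(2)[of t i] k(2)[OF i] assms(5,6) by (auto simp: s_def)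
  have max: "g l r \<le> g k s" if "0 \<le> r" "r \<le> T" for l r
  proof (cases "l \<in> I")
    case True
    then show ?thesis using top(2)[of r l] k(2)[OF True] that by (auto simp: s_def)
  next
    case False
    then show ?thesis using in_I[of l r] that ge by linarith
  qed
  have "0 < g k s" using ge pos by linarith
  then have dpos: "0 < d k s" by (simp add: g_def zero_less_mult_iff)
  then have "s \<noteq> 0" using init[of k] by auto
  have deriv_g: "(g k has_real_derivative (d' k s - C * d k s) * exp (- C * s - \<bar>real_of_int k\<bar>)) (at s within {0..T})"
    unfolding g_def using deriv[OF s, of k]
    by (auto intro!: derivative_eq_intros simp: algebra_simps)
  have nonneg: "0 \<le> d' k s - C * d k s"
  proof (rule ccontr)
    assume "\<not> ?thesis"
    then have "(d' k s - C * d k s) * exp (- C * s - \<bar>real_of_int k\<bar>) < 0"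
      by (simp add: mult_less_0_iff)
    from has_real_derivative_neg_dec_left[OF deriv_g this]
    obtain e where e: "0 < e" "\<And>h. 0 < h \<Longrightarrow> s - h \<in> {0..T} \<Longrightarrow> h < e \<Longrightarrow> g k s < g k (s - h)" by blast
    have "g k s < g k (s - min (e / 2) s)" using e(1) s \<open>s \<noteq> 0\<close> by (intro e(2)) auto
    moreover have "g k (s - min (e / 2) s) \<le> g k s" using e(1) s by (intro max) auto
    ultimately show False by simp
  qed
  have neighbour: "max 0 (d l s) \<le> exp 1 * d k s" if "\<bar>l - k\<bar> \<le> 1" for l
  proof -
    have "d l s = g l s * exp (C * s + \<bar>real_of_int l\<bar>)" by (simp add: g_def flip: exp_add)
    also have "\<dots> \<le> g k s * exp (C * s + \<bar>real_of_int l\<bar>)" using max[OF s] by (intro mult_right_mono) auto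
    also have "\<dots> = d k s * exp (\<bar>real_of_int l\<bar> - \<bar>real_of_int k\<bar>)" by (simp add: g_def flip: exp_add)
    also have "\<dots> \<le> d k s * exp 1" using dpos that by (intro mult_left_mono) auto
    finally show ?thesis using dpos by (simp add: mult.commute)
  qed
  have "d' k s \<le> exp 1 * d k s + exp 1 * d k s + K * d k s"
    using growth[OF s dpos] neighbour[of "k + 1", simplified] neighbour[of "k - 1", simplified] by linarith
  also have "\<dots> < C * d k s" using dpos by (simp add: C_def algebra_simps)
  finally show False using nonneg by simp
qed

text \<open>Only the difference is required to be bounded above: the supersolution that is used
  below grows exponentially in space.\<close>

lemma comparison_principle:
  assumes \<delta>: "0 < \<delta>" "\<delta> \<le> 1 / 3"
    and u: "\<And>i t. 0 \<le> t \<Longrightarrow> t \<le> T \<Longrightarrow> (u i has_real_derivative u' i t) (at t within {0..T})"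
    and v: "\<And>i t. 0 \<le> t \<Longrightarrow> t \<le> T \<Longrightarrow> (v i has_real_derivative v' i t) (at t within {0..T})"
    and sub: "\<And>i t. 0 \<le> t \<Longrightarrow> t \<le> T \<Longrightarrow> u' i t \<le> rhs F \<delta> \<omega> (\<lambda>k. u k t) i"
    and super: "\<And>i t. 0 \<le> t \<Longrightarrow> t \<le> T \<Longrightarrow> rhs F \<delta> \<omega> (\<lambda>k. v k t) i \<le> v' i t"
    and init: "\<And>i. u i 0 \<le> v i 0"
    and bound: "\<And>i t. 0 \<le> t \<Longrightarrow> t \<le> T \<Longrightarrow> u i t - v i t \<le> B"
    and t: "0 \<le> t" "t \<le> T"
  shows "u i t \<le> v i t"
proof -
  have "u i t - v i t \<le> 0"
  proof (rule discrete_maximum_principle[where d = "\<lambda>i t. u i t - v i t" and d' = "\<lambda>i t. u' i t - v' i t" and K = "1 / \<delta>"])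
    fix i t assume *: "0 \<le> t" "t \<le> T" "0 < u i t - v i t"
    have "u' i t - v' i t \<le> rhs F \<delta> \<omega> (\<lambda>k. u k t) i - rhs F \<delta> \<omega> (\<lambda>k. v k t) i"
      using sub[OF *(1,2)] super[OF *(1,2)] by (intro diff_mono)
    also have "\<dots> \<le> (u (i + 1) t - v (i + 1) t) + (u (i - 1) t - v (i - 1) t)
        + (obstacle_force \<delta> \<omega> i (v i t) - obstacle_force \<delta> \<omega> i (u i t))"
      using *(3) by (simp add: rhs_def laplacian_def)
    also have "obstacle_force \<delta> \<omega> i (v i t) - obstacle_force \<delta> \<omega> i (u i t) \<le> 1 / \<delta> * (u i t - v i t)"
      using obstacle_force_lipschitz[OF \<delta>, of \<omega> i "v i t" "u i t"] *(3) by (simp add: abs_if split: if_splits)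
    finally show "u' i t - v' i t \<le> max 0 (u (i + 1) t - v (i + 1) t) + max 0 (u (i - 1) t - v (i - 1) t)
        + 1 / \<delta> * (u i t - v i t)" by linarith
  qed (use init bound t in \<open>auto intro!: DERIV_diff u v\<close>)
  then show ?thesis by simp
qed

lemma evolution_solution_deriv:
  assumes "evolution_solution F \<delta> \<omega> u" "0 \<le> t" "S \<subseteq> {0..}"
  shows "(u i has_real_derivative rhs F \<delta> \<omega> (\<lambda>k. u k t) i) (at t within S)"
  using assms unfolding evolution_solution_def by (meson DERIV_subset)

lemma evolution_solution_bounded:
  assumes "evolution_solution F \<delta> \<omega> u" "0 \<le> T"
  obtains B where "\<And>i t. 0 \<le> t \<Longrightarrow> t \<le> T \<Longrightarrow> \<bar>u i t\<bar> \<le> B"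
proof -
  have "bdd_above {\<bar>u i s\<bar> | i s. 0 \<le> s \<and> s \<le> T}" using assms by (auto simp: evolution_solution_def)
  then obtain B where "\<And>x. x \<in> {\<bar>u i s\<bar> | i s. 0 \<le> s \<and> s \<le> T} \<Longrightarrow> x \<le> B" by (meson bdd_above.E)
  then show ?thesis using that by blast
qed

lemma obstacle_force_0:
  assumes "0 < \<delta>" "\<delta> \<le> 1"
  shows "obstacle_force \<delta> \<omega> i 0 = 0"
  using assms by (intro obstacle_force_away) auto

lemma evolution_solution_nonneg:
  assumes \<delta>: "0 < \<delta>" "\<delta> \<le> 1 / 3" and F: "0 \<le> F" and u: "evolution_solution F \<delta> \<omega> u" and t: "0 \<le> t"
  shows "0 \<le> u i t"
proof -
  obtain B where B: "\<And>i s. 0 \<le> s \<Longrightarrow> s \<le> t \<Longrightarrow> \<bar>u i s\<bar> \<le> B"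
    using evolution_solution_bounded[OF u t] by blast
  show ?thesis
  proof (rule comparison_principle[where u = "\<lambda>_ _. 0" and v = u and T = t and u' = "\<lambda>_ _. 0"])
    show "(u i has_real_derivative rhs F \<delta> \<omega> (\<lambda>k. u k s) i) (at s within {0..t})" if "0 \<le> s" "s \<le> t" for i s
      using evolution_solution_deriv[OF u] that by auto
    show "0 - u i s \<le> B" if "0 \<le> s" "s \<le> t" for i s using B[OF that, of i] by linarith
  qed (use \<delta> F t u in \<open>auto simp: rhs_def laplacian_def obstacle_force_0 evolution_solution_def\<close>)
qed

text \<open>The time shift of a solution is again a solution, and it starts above 0.\<close>

lemma evolution_solution_mono:
  assumes \<delta>: "0 < \<delta>" "\<delta> \<le> 1 / 3" and F: "0 \<le> F" and u: "evolution_solution F \<delta> \<omega> u"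
    and t: "0 \<le> s" "s \<le> t"
  shows "u i s \<le> u i t"
proof -
  define h where "h = t - s"
  have h: "0 \<le> h" using t by (simp add: h_def)
  obtain B where B: "\<And>i r. 0 \<le> r \<Longrightarrow> r \<le> t \<Longrightarrow> \<bar>u i r\<bar> \<le> B"
    using evolution_solution_bounded[OF u] t by (meson order_trans)
  have "u i s \<le> u i (s + h)"
  proof (rule comparison_principle[where u = u and v = "\<lambda>i r. u i (r + h)" and T = s])
    show "(u i has_real_derivative rhs F \<delta> \<omega> (\<lambda>k. u k r) i) (at r within {0..s})" if "0 \<le> r" "r \<le> s" for i r
      using evolution_solution_deriv[OF u] that by auto
    show "((\<lambda>r. u i (r + h)) has_real_derivative rhs F \<delta> \<omega> (\<lambda>k. u k (r + h)) i) (at r within {0..s})"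
      if "0 \<le> r" "r \<le> s" for i r
    proof -
      have "(u i has_real_derivative rhs F \<delta> \<omega> (\<lambda>k. u k (r + h)) i) (at (r + h) within (\<lambda>r. r + h) ` {0..s})"
        using that h by (intro evolution_solution_deriv[OF u]) auto
      moreover have "((\<lambda>r. r + h) has_real_derivative 1) (at r within {0..s})"
        by (auto intro!: derivative_eq_intros)
      ultimately have "(u i \<circ> (\<lambda>r. r + h) has_real_derivative rhs F \<delta> \<omega> (\<lambda>k. u k (r + h)) i * 1) (at r within {0..s})"
        by (rule DERIV_image_chain)
      then show ?thesis by (simp add: o_def)
    qed
    show "u i 0 \<le> u i (0 + h)" for i
      using u evolution_solution_nonneg[OF \<delta> F u h] by (simp add: evolution_solution_def)
    show "u i r - u i (r + h) \<le> 2 * B" if "0 \<le> r" "r \<le> s" for i r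
      using B[of r i] B[of "r + h" i] that t h by (auto simp: h_def)
  qed (use \<delta> t in auto)
  then show ?thesis by (simp add: h_def)
qed

lemma mono_tendsto_at_top_or_const:
  fixes g :: "real \<Rightarrow> real"
  assumes mono: "\<And>s t. 0 \<le> s \<Longrightarrow> s \<le> t \<Longrightarrow> g s \<le> g t"
  shows "filterlim g at_top at_top \<or> (\<exists>c. (g \<longlongrightarrow> c) at_top \<and> (\<forall>t\<ge>0. g t \<le> c))"
proof (cases "bdd_above (g ` {0..})")
  case True
  define c where "c = Sup (g ` {0..})"
  have le: "g t \<le> c" if "0 \<le> t" for t
    unfolding c_def using True that by (intro cSup_upper) auto
  have "(g \<longlongrightarrow> c) at_top"
  proof (rule order_tendstoI)
    fix a assume "a < c"
    then obtain s where s: "0 \<le> s" "a < g s"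
    proof -
      have "g ` {0..} \<noteq> {}" by simp
      with \<open>a < c\<close> obtain x where "x \<in> g ` {0..}" "a < x" unfolding c_def by (rule less_cSupE)
      then show ?thesis using that by auto
    qed
    then have "a < g t" if "s \<le> t" for t using mono[OF s(1) that] by linarith
    then show "\<forall>\<^sub>F t in at_top. a < g t" by (rule eventually_at_top_linorderI)
  next
    fix a assume "c < a"
    then have "g t < a" if "0 \<le> t" for t using le[OF that] by linarith
    then show "\<forall>\<^sub>F t in at_top. g t < a" by (rule eventually_at_top_linorderI)
  qed
  then show ?thesis using le by blast
next
  case False
  have "\<forall>\<^sub>F t in at_top. Z \<le> g t" for Z
  proof -
    have "\<exists>x\<in>g ` {0..}. Z < x" using False unfolding bdd_above_def by (meson not_le)
    then obtain s where s: "0 \<le> s" "Z < g s" by auto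
    then have "Z \<le> g t" if "s \<le> t" for t using mono[OF s(1) that] by linarith
    then show ?thesis by (rule eventually_at_top_linorderI)
  qed
  then show ?thesis by (simp add: filterlim_at_top)
qed

lemma derivative_tendsto_at_top:
  fixes g g' :: "real \<Rightarrow> real"
  assumes deriv: "\<And>t. 0 \<le> t \<Longrightarrow> (g has_real_derivative g' t) (at t within {0..})"
    and "0 < c" and ge: "\<forall>\<^sub>F t in at_top. c \<le> g' t"
  shows "filterlim g at_top at_top"
proof -
  obtain T0 where T0: "\<And>t. T0 \<le> t \<Longrightarrow> c \<le> g' t" using ge by (auto simp: eventually_at_top_linorder)
  define T where "T = max T0 1"
  have lower: "g T + c * (t - T) \<le> g t" if "T \<le> t" for t
  proof (cases "T = t")
    case False
    have d: "(g has_real_derivative g' x) (at x)" if "T \<le> x" for x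
    proof -
      have "x \<in> interior {0..}" using that by (simp add: T_def)
      then show ?thesis using deriv[of x] that at_within_interior[of x "{0..}"] by (simp add: T_def)
    qed
    have "T < t" using False that by simp
    from MVT2[OF this, of g g'] d
    obtain z where z: "T < z" "z < t" "g t - g T = (t - T) * g' z" by blast
    have "c * (t - T) \<le> g' z * (t - T)"
      using T0[of z] z that by (intro mult_right_mono) (auto simp: T_def)
    then show ?thesis using z(3) by (simp add: algebra_simps)
  qed simp
  have "\<forall>\<^sub>F t in at_top. Z \<le> g t" for Z
    using eventually_ge_at_top[of T] eventually_ge_at_top[of "T + (Z - g T) / c"]
  proof eventually_elim
    case (elim t)
    then have "Z - g T \<le> c * (t - T)" using \<open>0 < c\<close> by (simp add: field_simps)
    then show ?case using lower[OF elim(1)] by linarith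
  qed
  then show ?thesis by (simp add: filterlim_at_top)
qed

text \<open>A monotone function either tends to infinity or converges. If it converges at one site, the
  neighbours cannot tend to infinity, since they would drag that site along; so all sites converge.
  The limit is stationary, because a function whose derivative tends to a nonzero number does
  not converge.\<close>

lemma evolution_solution_at_top:
  assumes \<delta>: "0 < \<delta>" "\<delta> \<le> 1 / 3" and F: "0 \<le> F" and u: "evolution_solution F \<delta> \<omega> u"
    and none: "\<nexists>w. nonneg_stationary_solution F \<delta> \<omega> w"
  shows "filterlim (u i) at_top at_top"
proof (rule ccontr)
  assume bounded: "\<not> filterlim (u i) at_top at_top"
  note nonneg = evolution_solution_nonneg[OF \<delta> F u]
  have dichotomy: "filterlim (u k) at_top at_top \<or> (\<exists>c. (u k \<longlongrightarrow> c) at_top \<and> (\<forall>t\<ge>0. u k t \<le> c))" for k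
    using evolution_solution_mono[OF \<delta> F u] by (intro mono_tendsto_at_top_or_const)
  have deriv: "(u k has_real_derivative rhs F \<delta> \<omega> (\<lambda>k. u k t) k) (at t within {0..})" if "0 \<le> t" for k t
    using evolution_solution_deriv[OF u that] by auto
  have neighbour: "\<not> filterlim (u l) at_top at_top"
    if k: "\<not> filterlim (u k) at_top at_top" and l: "\<bar>l - k\<bar> = 1" for k l
  proof
    assume top: "filterlim (u l) at_top at_top"
    obtain c where c: "\<And>t. 0 \<le> t \<Longrightarrow> u k t \<le> c" using dichotomy[of k] k by blast
    have "\<forall>\<^sub>F t in at_top. 2 * c + 2 \<le> u l t" using top by (simp add: filterlim_at_top)
    then have "\<forall>\<^sub>F t in at_top. 1 \<le> rhs F \<delta> \<omega> (\<lambda>k. u k t) k"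
      using eventually_ge_at_top[of 0]
    proof eventually_elim
      case (elim t)
      have "l = k + 1 \<or> l = k - 1" using l by linarith
      then have "2 * c + 2 \<le> u (k + 1) t + u (k - 1) t"
        using elim nonneg[of t "k + 1"] nonneg[of t "k - 1"] by auto
      then show ?case
        using c[of t] elim F obstacle_force_bounds(2)[of \<delta> \<omega> k "u k t"] \<delta> by (simp add: rhs_def laplacian_def)
    qed
    then have "filterlim (u k) at_top at_top"
      using deriv by (intro derivative_tendsto_at_top[where c = 1 and g' = "\<lambda>t. rhs F \<delta> \<omega> (\<lambda>k. u k t) k"]) auto
    then show False using k by simp
  qed
  have "\<not> filterlim (u k) at_top at_top" for k
  proof (induction k rule: int_induct[where k = i])
    case (step1 k)
    then show ?case using neighbour[of k "k + 1"] by simp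
  next
    case (step2 k)
    then show ?case using neighbour[of k "k - 1"] by simp
  qed (fact bounded)
  then obtain w where w: "\<And>k. (u k \<longlongrightarrow> w k) at_top" using dichotomy by metis
  have "0 \<le> w k" for k
  proof (rule tendsto_lowerbound[OF w])
    show "\<forall>\<^sub>F t in at_top. 0 \<le> u k t" using eventually_ge_at_top[of 0] by eventually_elim (rule nonneg)
  qed simp
  moreover have "rhs F \<delta> \<omega> w k = 0" for k
  proof -
    have "(1 / \<delta>)-lipschitz_on UNIV (obstacle_force \<delta> \<omega> k)"
      using obstacle_force_lipschitz[OF \<delta>] \<delta> by (intro lipschitz_onI) (auto simp: dist_real_def)
    then have "isCont (obstacle_force \<delta> \<omega> k) (w k)"
      using lipschitz_on_continuous_on continuous_on_eq_continuous_at open_UNIV by blast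
    then have "((\<lambda>t. obstacle_force \<delta> \<omega> k (u k t)) \<longlongrightarrow> obstacle_force \<delta> \<omega> k (w k)) at_top"
      using w by (rule isCont_tendsto_compose)
    then have lim: "((\<lambda>t. rhs F \<delta> \<omega> (\<lambda>k. u k t) k) \<longlongrightarrow> rhs F \<delta> \<omega> w k) at_top"
      unfolding rhs_def laplacian_def by (intro tendsto_intros w)
    have not_top: "\<not> filterlim (u k) at_top at_top" "\<not> filterlim (\<lambda>t. - u k t) at_top at_top"
      using w[of k] tendsto_minus[OF w[of k]] by (auto dest: not_tendsto_and_filterlim_at_infinity[OF _ _ filterlim_at_top_imp_at_infinity, rotated])
    consider "rhs F \<delta> \<omega> w k = 0" | "0 < rhs F \<delta> \<omega> w k" | "rhs F \<delta> \<omega> w k < 0" by linarith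
    then show ?thesis
    proof cases
      case 2
      then have "\<forall>\<^sub>F t in at_top. rhs F \<delta> \<omega> w k / 2 < rhs F \<delta> \<omega> (\<lambda>k. u k t) k"
        using order_tendstoD(1)[OF lim, of "rhs F \<delta> \<omega> w k / 2"] by simp
      then have "filterlim (u k) at_top at_top" using 2 deriv
        by (intro derivative_tendsto_at_top[where c = "rhs F \<delta> \<omega> w k / 2" and g' = "\<lambda>t. rhs F \<delta> \<omega> (\<lambda>k. u k t) k"])
          (auto elim: eventually_mono)
      then show ?thesis using not_top by simp
    next
      case 3
      then have "\<forall>\<^sub>F t in at_top. rhs F \<delta> \<omega> (\<lambda>k. u k t) k < rhs F \<delta> \<omega> w k / 2"
        using order_tendstoD(2)[OF lim, of "rhs F \<delta> \<omega> w k / 2"] by simp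
      then have "filterlim (\<lambda>t. - u k t) at_top at_top" using 3 deriv
        by (intro derivative_tendsto_at_top[where c = "- rhs F \<delta> \<omega> w k / 2" and g' = "\<lambda>t. - rhs F \<delta> \<omega> (\<lambda>k. u k t) k"])
          (auto elim: eventually_mono intro!: DERIV_minus)
      then show ?thesis using not_top by simp
    qed
  qed
  ultimately have "nonneg_stationary_solution F \<delta> \<omega> w" by (simp add: nonneg_stationary_solution_def)
  then show False using none by blast
qed

section \<open>Long runs of obstacles slow the interface down\<close>

text \<open>An upper bound for the speed at which obstacle-free surroundings can eat into a run of
  obstacles. The first term is the speed of \<open>exp \<bar>i\<bar>\<close> under the discrete Laplacian, the second one
  absorbs the driving force.\<close>

definition front_speed :: "real \<Rightarrow> real \<Rightarrow> real" where
  "front_speed F \<delta> = 2 * exp 1 + F / (2 * ((1 - F) * \<delta>))"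

text \<open>The supersolution is \<open>j + 1 - \<theta> + h\<close>, where \<open>h\<close> is exponential in space and moves inwards. Here
  \<open>\<theta> = (1 - F) * \<delta>\<close> is the distance from the centre of a hat at which the obstacle
  just balances the driving force. Where \<open>h \<le> 2 * \<theta>\<close>, the site is within the run and the profile
  within \<open>\<theta>\<close> of the row, so that the obstacles cancel the force; elsewhere \<open>h\<close> is so large that its own growth
  outweighs the force.\<close>

lemma pinned_up_to_crossing_time:
  assumes \<delta>: "0 < \<delta>" "\<delta> \<le> 1 / 3" and F: "0 \<le> F" "F < 1" and u: "evolution_solution F \<delta> \<omega> u"
    and run: "\<And>i. \<bar>i\<bar> \<le> int L \<Longrightarrow> \<not> \<omega> j i"
    and t: "0 \<le> t" "front_speed F \<delta> * t \<le> real L"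
  shows "u 0 t \<le> real j + 2"
proof -
  define \<theta> where "\<theta> = (1 - F) * \<delta>"
  define \<kappa> where "\<kappa> = front_speed F \<delta>"
  have "(1 - F) * \<delta> \<le> 1 * (1 / 3)" using \<delta> F by (intro mult_mono) auto
  then have \<theta>: "0 < \<theta>" "\<theta> \<le> 1 / 3" using \<delta> F by (auto simp: \<theta>_def)
  have \<kappa>: "0 \<le> \<kappa>" "\<kappa> = 2 * exp 1 + F / (2 * \<theta>)"
    using \<theta> F by (auto simp: \<kappa>_def front_speed_def \<theta>_def)
  define h where "h i s = 2 * \<theta> * exp (\<kappa> * s + \<bar>real_of_int i\<bar> - real L)" for i :: int and s :: real
  define v where "v i s = real j + 1 - \<theta> + h i s" for i s
  have h_pos: "0 < h i s" for i s using \<theta> by (simp add: h_def)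
  obtain B where B: "\<And>i s. 0 \<le> s \<Longrightarrow> s \<le> t \<Longrightarrow> \<bar>u i s\<bar> \<le> B"
    using evolution_solution_bounded[OF u t(1)] by blast
  have lap: "laplacian (\<lambda>k. v k s) i \<le> 2 * exp 1 * h i s" for i s
  proof -
    have "h k s \<le> exp 1 * h i s" if "\<bar>k - i\<bar> \<le> 1" for k
    proof -
      have "\<bar>real_of_int k\<bar> \<le> 1 + \<bar>real_of_int i\<bar>" using that by linarith
      then show ?thesis using \<theta> by (simp add: h_def flip: exp_add)
    qed
    from this[of "i + 1"] this[of "i - 1"] h_pos[of i s] show ?thesis
      by (simp add: laplacian_def v_def)
  qed
  have "u 0 t \<le> v 0 t"
  proof (rule comparison_principle[where u = u and v = v and T = t and v' = "\<lambda>i s. \<kappa> * h i s"])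
    show "(u i has_real_derivative rhs F \<delta> \<omega> (\<lambda>k. u k s) i) (at s within {0..t})" if "0 \<le> s" "s \<le> t" for i s
      using evolution_solution_deriv[OF u] that by auto
    show "(v i has_real_derivative \<kappa> * h i s) (at s within {0..t})" for i s
      unfolding v_def h_def by (auto intro!: derivative_eq_intros)
    show "rhs F \<delta> \<omega> (\<lambda>k. v k s) i \<le> \<kappa> * h i s" if s: "0 \<le> s" "s \<le> t" for i s
    proof (cases "h i s \<le> 2 * \<theta>")
      case True
      then have "exp (\<kappa> * s + \<bar>real_of_int i\<bar> - real L) \<le> 1" using \<theta> by (simp add: h_def)
      moreover have "0 \<le> \<kappa> * s" using \<kappa> s by simp
      ultimately have "\<bar>real_of_int i\<bar> \<le> real L" by simp
      then have "\<not> \<omega> j i" by (intro run) linarith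
      have close: "\<bar>v i s - (real j + 1)\<bar> \<le> \<theta>" using True h_pos[of i s] by (auto simp: v_def)
      moreover have "\<theta> \<le> 1 - \<delta>" using \<theta> \<delta> by simp
      ultimately have "obstacle_force \<delta> \<omega> i (v i s) = hat \<delta> (v i s - (real j + 1))"
        using obstacle_force_near_row[OF \<delta>(1), of "v i s" j \<omega> i] \<open>\<not> \<omega> j i\<close> by (simp add: Q_def)
      moreover have "\<bar>v i s - (real j + 1)\<bar> / \<delta> \<le> 1 - F"
        using close \<delta> by (simp add: \<theta>_def field_simps)
      ultimately have "F \<le> obstacle_force \<delta> \<omega> i (v i s)" by (simp add: hat_def)
      then have "rhs F \<delta> \<omega> (\<lambda>k. v k s) i \<le> 2 * exp 1 * h i s"
        using lap[of s i] by (simp add: rhs_def)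
      also have "\<dots> \<le> \<kappa> * h i s" using h_pos[of i s] \<kappa>(2) \<theta> F by (intro mult_right_mono) auto
      finally show ?thesis .
    next
      case False
      have "F = F / (2 * \<theta>) * (2 * \<theta>)" using \<theta> by simp
      also have "\<dots> \<le> F / (2 * \<theta>) * h i s" using False \<theta> F by (intro mult_left_mono) auto
      finally have "F \<le> F / (2 * \<theta>) * h i s" .
      moreover have "0 \<le> obstacle_force \<delta> \<omega> i (v i s)" using obstacle_force_bounds \<delta> by simp
      ultimately show ?thesis using lap[of s i] by (simp add: rhs_def \<kappa>(2) distrib_right)
    qed
    show "u i 0 \<le> v i 0" for i
      using u h_pos[of i 0] \<theta> by (simp add: evolution_solution_def v_def)
    show "u i s - v i s \<le> B" if "0 \<le> s" "s \<le> t" for i s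
      using B[OF that, of i] h_pos[of i s] \<theta> by (auto simp: v_def)
  qed (use \<delta> t in auto)
  also have "v 0 t \<le> real j + 1 + \<theta>"
    using t(2) \<theta> by (simp add: v_def h_def \<kappa>_def)
  also have "\<dots> \<le> real j + 2" using \<theta> by simp
  finally show ?thesis .
qed

text \<open>A run of length \<open>4^k\<close> in a row below \<open>2^k\<close> holds the origin below \<open>2^k + 2\<close> up to a time of order
  \<open>4^k\<close>; interpolating between consecutive \<open>k\<close> gives \<open>u 0 t = O(sqrt t)\<close>.\<close>

lemma sublinear_of_long_runs:
  assumes \<delta>: "0 < \<delta>" "\<delta> \<le> 1 / 3" and F: "0 \<le> F" "F < 1" and u: "evolution_solution F \<delta> \<omega> u"
    and runs: "\<forall>\<^sub>F k in sequentially. \<exists>j<2^k. \<forall>i. \<bar>i\<bar> \<le> 4^k \<longrightarrow> \<not> \<omega> j i"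
  shows "((\<lambda>t. u 0 t / t) \<longlongrightarrow> 0) at_top"
proof -
  define \<kappa> where "\<kappa> = front_speed F \<delta>"
  have "0 \<le> F / (2 * ((1 - F) * \<delta>))" using F \<delta> by auto
  moreover have "(0::real) < exp 1" by simp
  ultimately have \<kappa>: "0 < \<kappa>" unfolding \<kappa>_def front_speed_def by linarith
  obtain k0 where k0: "\<And>k. k0 \<le> k \<Longrightarrow> \<exists>j<2^k. \<forall>i. \<bar>i\<bar> \<le> 4^k \<longrightarrow> \<not> \<omega> j i"
    using runs by (auto simp: eventually_sequentially)
  have bound: "u 0 t \<le> 2 * sqrt (\<kappa> * t) + 2" if "4^k0 \<le> \<kappa> * t" for t
  proof -
    obtain n where n: "\<kappa> * t < 4^n" using real_arch_pow[of 4 "\<kappa> * t"] by auto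
    define k where "k = (LEAST k. \<kappa> * t < 4^k)"
    have k: "\<kappa> * t < 4^k" unfolding k_def by (rule LeastI[of "\<lambda>k. \<kappa> * t < 4^k", OF n])
    have "(4::real)^k0 < 4^k" using that k by linarith
    then have "k0 < k" by (simp add: power_strict_increasing_iff)
    then obtain k' where k': "k = Suc k'" by (cases k) auto
    have "\<not> \<kappa> * t < 4^k'" using not_less_Least[of k' "\<lambda>k. \<kappa> * t < 4^k"] k' by (simp flip: k_def)
    then have "sqrt (4^k') \<le> sqrt (\<kappa> * t)" by simp
    moreover have "sqrt (4^k') = 2^k'"
      by (simp add: real_sqrt_power)
    ultimately have sqrt: "2 ^ k \<le> 2 * sqrt (\<kappa> * t)" by (simp add: k')
    obtain j where j: "j < 2^k" "\<And>i. \<bar>i\<bar> \<le> 4^k \<Longrightarrow> \<not> \<omega> j i" using k0[of k] \<open>k0 < k\<close> by auto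
    have "0 < \<kappa> * t" using that by (rule less_le_trans[rotated]) simp
    then have "0 \<le> t" using \<kappa> by (simp add: zero_less_mult_iff)
    then have "u 0 t \<le> real j + 2"
      using j(2) k by (intro pinned_up_to_crossing_time[OF \<delta> F u, of "4^k"]) (auto simp flip: \<kappa>_def)
    also have "real j \<le> 2^k" using j(1) by (metis of_nat_less_numeral_power_cancel_iff less_imp_le)
    finally show ?thesis using sqrt by simp
  qed
  show ?thesis
  proof (rule tendsto_sandwich[where f = "\<lambda>_. 0"])
    show "\<forall>\<^sub>F t in at_top. 0 \<le> u 0 t / t"
      using eventually_ge_at_top[of 0] by eventually_elim (simp add: evolution_solution_nonneg[OF \<delta> F(1) u])
    show "\<forall>\<^sub>F t in at_top. u 0 t / t \<le> (2 * sqrt (\<kappa> * t) + 2) / t"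
      using eventually_ge_at_top[of "4^k0 / \<kappa>"] eventually_gt_at_top[of 0]
    proof eventually_elim
      case (elim t)
      then show ?case using bound[of t] \<kappa> by (intro divide_right_mono) (auto simp: field_simps)
    qed
    show "((\<lambda>t. (2 * sqrt (\<kappa> * t) + 2) / t) \<longlongrightarrow> 0) at_top"
    proof -
      have "((\<lambda>t. 2 * sqrt \<kappa> * inverse (sqrt t) + 2 * inverse t) \<longlongrightarrow> 2 * sqrt \<kappa> * 0 + 2 * 0) at_top"
        by (intro tendsto_intros tendsto_inverse_0_at_top sqrt_at_top filterlim_ident)
      moreover have "\<forall>\<^sub>F t in at_top. 2 * sqrt \<kappa> * inverse (sqrt t) + 2 * inverse t = (2 * sqrt (\<kappa> * t) + 2) / t"
        using eventually_gt_at_top[of 0]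
      proof eventually_elim
        case (elim t)
        then have "inverse (sqrt t) = sqrt t / t" by (simp add: field_simps)
        then show ?case by (simp add: real_sqrt_mult divide_inverse algebra_simps)
      qed
      ultimately show ?thesis by (simp add: tendsto_cong)
    qed
  qed simp
qed

section \<open>Existence of the evolution\<close>

text \<open>Picard iteration. Weighting curves by \<open>exp (- 2 * L * t)\<close> turns the integral operator into a
  contraction on all of \<open>{0..}\<close> at once, so that no continuation of local solutions is needed. The weighted
  curves are extended to negative times by their value at 0.\<close>

lemma lipschitz_ode_global_solution:
  fixes N :: "'a::banach \<Rightarrow> 'a" and x0 :: 'a
  assumes L: "0 < L" and lip: "\<And>x y. norm (N x - N y) \<le> L * norm (x - y)"
  shows "\<exists>x :: real \<Rightarrow> 'a. x 0 = x0 \<and> continuous_on UNIV x \<and>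
    (\<forall>t\<ge>0. (x has_vector_derivative N (x t)) (at t within {0..}))"
proof -
  define C where "C = 2 * L"
  have C: "0 < C" using L by (simp add: C_def)
  have contN: "continuous_on UNIV N"
  proof -
    have "L-lipschitz_on UNIV N" using lip L by (intro lipschitz_onI) (auto simp: dist_norm)
    then show ?thesis by (rule lipschitz_on_continuous_on)
  qed
  \<comment> \<open>the curve described by a bounded weighted curve\<close>
  define W where "W v s = exp (C * s) *\<^sub>R apply_bcontfun v s" for v :: "real \<Rightarrow>\<^sub>C 'a" and s :: real
  have contW: "continuous_on S (W v)" for v S
    unfolding W_def by (intro continuous_intros continuous_on_apply_bcontfun)
  have contNW: "continuous_on S (\<lambda>s. N (W v s))" for v S
    using continuous_on_compose2[OF contN contW] by blast
  have intNW: "(\<lambda>s. N (W v s)) integrable_on {a..b}" for v a b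
    by (intro integrable_continuous_real contNW)
  define J where "J v t = x0 + integral {0..t} (\<lambda>s. N (W v s))" for v and t :: real
  have derivJ: "(J v has_vector_derivative N (W v t)) (at t within {0..T})" if "0 \<le> t" "t \<le> T" for v t T
    unfolding J_def using that integral_has_vector_derivative[OF contNW, of t 0 T v]
    by (auto intro!: derivative_eq_intros)
  have contJ: "continuous_on {0..} (J v)" for v
  proof (rule continuous_on_eq_continuous_within[THEN iffD2], intro ballI)
    fix t :: real assume "t \<in> {0..}"
    then have t: "0 \<le> t" by simp
    have "continuous (at t within {0..t + 1}) (J v)"
      using derivJ[of t "t + 1" v] t has_vector_derivative_continuous by auto
    moreover have "at t within {0..t + 1} = at t within {0..}"
      using t by (intro at_within_nhd[of t "{..<t + 1}"]) auto
    ultimately show "continuous (at t within {0..}) (J v)" by simp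
  qed
  define P where "P v t = exp (- C * max 0 t) *\<^sub>R J v (max 0 t)" for v t
  have exp_integral: "((\<lambda>s. exp (C * s)) has_integral (exp (C * t) - 1) / C) {0..t}" if "0 \<le> t" for t
  proof -
    have "((\<lambda>s. exp (C * s) / C) has_vector_derivative exp (C * s)) (at s within {0..t})" for s
      using C by (auto intro!: derivative_eq_intros simp: has_real_derivative_iff_has_vector_derivative[symmetric])
    from fundamental_theorem_of_calculus[OF that this] show ?thesis by (simp add: diff_divide_distrib)
  qed
  have W_bound: "norm (W v s - W v' s) \<le> exp (C * s) * dist v v'" for v v' s
    unfolding W_def using dist_bounded[of v s v'] by (simp add: dist_norm flip: scaleR_diff_right)
  have J_diff: "norm (J v t - J v' t) \<le> exp (C * t) * (dist v v' / 2)" if "0 \<le> t" for v v' t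
  proof -
    have "J v t - J v' t = integral {0..t} (\<lambda>s. N (W v s) - N (W v' s))"
      unfolding J_def by (simp add: integral_diff intNW)
    also have "norm \<dots> \<le> integral {0..t} (\<lambda>s. L * dist v v' * exp (C * s))"
    proof (rule integral_norm_bound_integral)
      show "(\<lambda>s. N (W v s) - N (W v' s)) integrable_on {0..t}" by (intro integrable_diff intNW)
      show "(\<lambda>s. L * dist v v' * exp (C * s)) integrable_on {0..t}"
        by (intro integrable_continuous_real continuous_intros)
      fix s
      have "norm (N (W v s) - N (W v' s)) \<le> L * norm (W v s - W v' s)" by (rule lip)
      also have "\<dots> \<le> L * (exp (C * s) * dist v v')" using L W_bound by (intro mult_left_mono) auto
      finally show "norm (N (W v s) - N (W v' s)) \<le> L * dist v v' * exp (C * s)" by (simp add: ac_simps)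
    qed
    also have "\<dots> = L * dist v v' * ((exp (C * t) - 1) / C)"
      using exp_integral[OF that] by (intro integral_unique has_integral_mult_right)
    also have "\<dots> \<le> exp (C * t) * (dist v v' / 2)"
      using L by (simp add: C_def field_simps mult_right_mono)
    finally show ?thesis .
  qed
  have contP: "continuous_on UNIV (P v)" for v
  proof -
    have "continuous_on UNIV (\<lambda>t. J v (max 0 t))"
      by (rule continuous_on_compose2[OF contJ]) (auto intro!: continuous_intros)
    then show ?thesis unfolding P_def by (intro continuous_intros)
  qed
  have P_diff: "norm (P v t - P v' t) \<le> dist v v' / 2" for v v' t
  proof -
    have "norm (P v t - P v' t) = exp (- C * max 0 t) * norm (J v (max 0 t) - J v' (max 0 t))"
      unfolding P_def by (simp flip: scaleR_diff_right)
    also have "\<dots> \<le> exp (- C * max 0 t) * (exp (C * max 0 t) * (dist v v' / 2))"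
      by (intro mult_left_mono J_diff) auto
    also have "\<dots> = dist v v' / 2" by (simp add: exp_minus field_simps)
    finally show ?thesis .
  qed
  have P0: "norm (P 0 t) \<le> norm x0 + norm (N 0) / C" for t
  proof -
    define r where "r = max 0 t"
    have r: "0 \<le> r" by (simp add: r_def)
    have "J 0 r = x0 + r *\<^sub>R N 0" using r by (simp add: J_def W_def)
    then have "norm (P 0 t) \<le> exp (- C * r) * (norm x0 + r * norm (N 0))"
      unfolding P_def r_def[symmetric] using norm_triangle_ineq[of x0 "r *\<^sub>R N 0"] r by simp
    also have "\<dots> = exp (- C * r) * norm x0 + (exp (- C * r) * r) * norm (N 0)" by (simp add: algebra_simps)
    also have "\<dots> \<le> 1 * norm x0 + 1 / C * norm (N 0)"
    proof (intro add_mono mult_right_mono)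
      have "C * r \<le> exp (C * r)" using exp_ge_add_one_self[of "C * r"] by linarith
      then show "exp (- C * r) * r \<le> 1 / C" using C by (simp add: exp_minus field_simps)
    qed (use C r in auto)
    finally show ?thesis by simp
  qed
  have P_bcontfun: "P v \<in> bcontfun" for v
  proof (rule bcontfun_normI[OF contP])
    fix t
    show "norm (P v t) \<le> dist v 0 / 2 + (norm x0 + norm (N 0) / C)"
      using P_diff[of v t 0] P0[of t] norm_triangle_sub[of "P v t" "P 0 t"] by linarith
  qed
  define \<Phi> where "\<Phi> v = Bcontfun (P v)" for v
  have \<Phi>: "apply_bcontfun (\<Phi> v) = P v" for v
    unfolding \<Phi>_def by (rule Bcontfun_inverse[OF P_bcontfun])
  have "dist (\<Phi> v) (\<Phi> v') \<le> 1 / 2 * dist v v'" for v v'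
    by (rule dist_bound) (use P_diff in \<open>auto simp: \<Phi> dist_norm\<close>)
  then obtain v where v: "\<Phi> v = v"
    using banach_fix_type[of "1 / 2" \<Phi>] by auto
  have WJ: "W v t = J v t" if "0 \<le> t" for t
  proof -
    have "W v t = exp (C * t) *\<^sub>R P v t" unfolding W_def using \<Phi>[of v] v by simp
    then show ?thesis using that by (simp add: P_def flip: exp_add)
  qed
  show ?thesis
  proof (intro exI[of _ "W v"] conjI allI impI)
    show "W v 0 = x0" using WJ[of 0] by (simp add: J_def)
    show "continuous_on UNIV (W v)" by (rule contW)
    fix t :: real assume t: "0 \<le> t"
    have "(J v has_vector_derivative N (W v t)) (at t within {0..t + 1})"
      using derivJ t by simp
    moreover have "at t within {0..t + 1} = at t within {0..}"
      using t by (intro at_within_nhd[of t "{..<t + 1}"]) auto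
    ultimately have "(J v has_vector_derivative N (W v t)) (at t within {0..})" by simp
    then show "(W v has_vector_derivative N (W v t)) (at t within {0..})"
      by (rule has_vector_derivative_transform[rotated 2]) (use WJ t in auto)
  qed
qed

instance bcontfun :: (metric_space, banach) banach ..

text \<open>The state space consists of the bounded sequences, realised as bounded continuous functions on the
  discrete space of integers. Boundedness of the states on compact time intervals
  is the uniform bound required of a solution.\<close>

lemma evolution_solution_exists:
  assumes \<delta>: "0 < \<delta>" "\<delta> \<le> 1 / 3"
  shows "\<exists>u. evolution_solution F \<delta> \<omega> u"
proof -
  define val where "val x i = apply_bcontfun x (discrete i)" for x :: "int discrete \<Rightarrow>\<^sub>C real" and i
  define N where "N x = Bcontfun (\<lambda>k. rhs F \<delta> \<omega> (val x) (of_discrete k))" for x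
  have val_norm: "\<bar>val x k\<bar> \<le> norm x" for x k
    using norm_bounded[of x "discrete k"] by (simp add: val_def)
  have val_diff: "val (x - y) k = val x k - val y k" for x y k by (simp add: val_def)
  have "(\<lambda>k. rhs F \<delta> \<omega> (val x) (of_discrete k)) \<in> bcontfun" for x
  proof (rule bcontfun_normI)
    show "continuous_on UNIV (\<lambda>k. rhs F \<delta> \<omega> (val x) (of_discrete k))"
      by (auto simp: continuous_on_open_vimage open_discrete)
    fix k :: "int discrete"
    define i where "i = of_discrete k"
    show "norm (rhs F \<delta> \<omega> (val x) (of_discrete k)) \<le> 4 * norm x + 1 + \<bar>F\<bar>"
      using val_norm[of x "i - 1"] val_norm[of x i] val_norm[of x "i + 1"]
        obstacle_force_bounds[of \<delta> \<omega> i "val x i"] \<delta> by (simp add: rhs_def laplacian_def flip: i_def)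
  qed
  then have N: "apply_bcontfun (N x) k = rhs F \<delta> \<omega> (val x) (of_discrete k)" for x k
    unfolding N_def by (simp add: Bcontfun_inverse)
  have lip: "norm (N x - N y) \<le> (4 + 1 / \<delta>) * norm (x - y)" for x y
  proof (rule norm_bound)
    fix k :: "int discrete"
    define i where "i = of_discrete k"
    have D: "\<bar>val x k - val y k\<bar> \<le> norm (x - y)" for k using val_norm[of "x - y" k] by (simp add: val_diff)
    have "\<bar>obstacle_force \<delta> \<omega> i (val x i) - obstacle_force \<delta> \<omega> i (val y i)\<bar> \<le> \<bar>val x i - val y i\<bar> / \<delta>"
      by (rule obstacle_force_lipschitz[OF \<delta>])
    also have "\<dots> \<le> norm (x - y) / \<delta>" using \<delta> D by (intro divide_right_mono) auto
    finally have "\<bar>rhs F \<delta> \<omega> (val x) i - rhs F \<delta> \<omega> (val y) i\<bar> \<le> 4 * norm (x - y) + norm (x - y) / \<delta>"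
      using D[of i] D[of "i + 1"] D[of "i - 1"] by (simp add: rhs_def laplacian_def)
    then show "norm ((N x - N y) k) \<le> (4 + 1 / \<delta>) * norm (x - y)"
      by (simp add: N i_def algebra_simps)
  qed
  obtain x :: "real \<Rightarrow> int discrete \<Rightarrow>\<^sub>C real" where x: "x 0 = 0" "continuous_on UNIV x"
      "\<And>t. 0 \<le> t \<Longrightarrow> (x has_vector_derivative N (x t)) (at t within {0..})"
    using lipschitz_ode_global_solution[OF _ lip, of 0] \<delta> by (auto simp: add_pos_pos)
  have lin: "bounded_linear (\<lambda>y. val y i)" for i
    by (rule bounded_linear_intro[where K = 1]) (use val_norm[of _ i] in \<open>auto simp: val_def\<close>)
  have "evolution_solution F \<delta> \<omega> (\<lambda>i t. val (x t) i)"
    unfolding evolution_solution_def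
  proof (intro conjI allI impI)
    show "val (x 0) i = 0" for i using x(1) by (simp add: val_def)
    show "((\<lambda>t. val (x t) i) has_real_derivative rhs F \<delta> \<omega> (\<lambda>k. val (x t) k) i) (at t within {0..})" if "0 \<le> t" for i t
    proof -
      have "val (N (x t)) i = rhs F \<delta> \<omega> (val (x t)) i" by (simp add: val_def[of "N _"] N discrete_inverse)
      then show ?thesis
        using bounded_linear.has_vector_derivative[OF lin x(3)[OF that], of i]
        by (simp add: has_real_derivative_iff_has_vector_derivative)
    qed
    show "bdd_above {\<bar>val (x s) i\<bar> |i s. 0 \<le> s \<and> s \<le> t}" if "0 \<le> t" for t
    proof -
      have "compact (x ` {0..t})"
        using x(2) continuous_on_subset by (intro compact_continuous_image) blast+
      then obtain B where "\<forall>y\<in>x ` {0..t}. norm y \<le> B"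
        using compact_imp_bounded bounded_iff by blast
      then have B: "norm (x s) \<le> B" if "0 \<le> s" "s \<le> t" for s using that by auto
      have "\<bar>val (x s) i\<bar> \<le> B" if "0 \<le> s" "s \<le> t" for s i
        using B[OF that] val_norm[of "x s" i] by linarith
      then show ?thesis by (auto intro!: bdd_aboveI)
    qed
  qed
  then show ?thesis by blast
qed

section \<open>Obstacle rays and long runs in a random environment\<close>

lemma space_config: "space (config_algebra :: (int \<Rightarrow> bool) measure) = UNIV"
  by (simp add: space_PiM)

lemma UNIV_config: "UNIV \<in> sets (config_algebra :: (int \<Rightarrow> bool) measure)"
  using sets.top[of "config_algebra :: (int \<Rightarrow> bool) measure"] unfolding space_config .

lemma config_event:
  assumes "Measurable.pred config_algebra P"
  shows "{\<eta>. P \<eta>} \<in> sets config_algebra"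
  using assms unfolding pred_def space_config by (simp only: UNIV_I simp_thms)

lemma measurable_next_point [measurable]:
  "(\<lambda>\<eta>. next_point \<eta> x) \<in> config_algebra \<rightarrow>\<^sub>M count_space UNIV"
  unfolding next_point_def by measurable

lemma measurable_prev_point [measurable]:
  "(\<lambda>\<eta>. prev_point \<eta> x) \<in> config_algebra \<rightarrow>\<^sub>M count_space UNIV"
  unfolding prev_point_def by measurable

lemma measurable_funpow_point:
  fixes h :: "(int \<Rightarrow> bool) \<Rightarrow> int \<Rightarrow> int"
  assumes "\<And>x. (\<lambda>\<eta>. h \<eta> x) \<in> config_algebra \<rightarrow>\<^sub>M count_space UNIV"
  shows "(\<lambda>\<eta>. (h \<eta> ^^ n) x) \<in> config_algebra \<rightarrow>\<^sub>M count_space UNIV"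
proof (induction n)
  case (Suc n)
  have "(\<lambda>\<eta>. h \<eta> ((h \<eta> ^^ n) x)) \<in> config_algebra \<rightarrow>\<^sub>M count_space UNIV"
    by (rule measurable_compose_countable[OF assms Suc])
  then show ?case by simp
qed simp

lemma measurable_gap [measurable]: "gap k \<in> config_algebra \<rightarrow>\<^sub>M count_space UNIV"
proof -
  have [measurable]: "(\<lambda>\<eta>. nth_point \<eta> k) \<in> config_algebra \<rightarrow>\<^sub>M count_space UNIV" for k
    unfolding nth_point_def by (cases "0 \<le> k") (simp_all add: measurable_funpow_point)
  show ?thesis unfolding gap_def[abs_def] by measurable
qed

lemma measurable_shift:
  "(\<lambda>\<eta> i. \<eta> (i + m)) \<in> config_algebra \<rightarrow>\<^sub>M (config_algebra :: (int \<Rightarrow> bool) measure)"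
  by (rule measurable_PiM_single') auto

text \<open>The claim also holds for configurations without a positive point, where \<open>gap 0 \<eta>\<close> is
  a meaningless default value.\<close>

lemma gap_0_no_point:
  assumes "n < gap 0 \<eta>" "0 < i" "i \<le> int n"
  shows "\<not> \<eta> i"
proof -
  have "gap 0 \<eta> = (LEAST n. 0 < n \<and> \<eta> (int n))"
    by (simp add: gap_def nth_point_def next_point_def)
  then have "nat i < (LEAST n. 0 < n \<and> \<eta> (int n))" using assms by linarith
  from not_less_Least[OF this] show ?thesis using assms by auto
qed

locale stationary_renewal =
  fixes G :: "nat pmf" and R :: "(int \<Rightarrow> bool) measure"
  assumes law: "stationary_renewal_law G R"
begin

sublocale prob_space R
  using law by (simp add: stationary_renewal_law_def)

lemma sets_R [measurable_cong, simp]: "sets R = sets config_algebra"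
  using law by (simp add: stationary_renewal_law_def)

lemma space_R [simp]: "space R = UNIV"
  using sets_eq_imp_space_eq[OF sets_R] by (simp add: space_PiM)

lemma event_Collect: "Measurable.pred config_algebra P \<Longrightarrow> {\<eta>. P \<eta>} \<in> events"
  unfolding sets_R by (rule config_event)

lemma prob_shift:
  assumes "Measurable.pred config_algebra P"
  shows "prob {\<eta>. P (\<lambda>i. \<eta> (i + m))} = prob {\<eta>. P \<eta>}"
proof -
  have "(\<lambda>\<eta> i. \<eta> (i + m)) \<in> R \<rightarrow>\<^sub>M R"
    unfolding measurable_cong_sets[OF sets_R sets_R] by (rule measurable_shift)
  then have "measure (distr R R (\<lambda>\<eta> i. \<eta> (i + m))) {\<eta>. P \<eta>} = prob ((\<lambda>\<eta> i. \<eta> (i + m)) -` {\<eta>. P \<eta>} \<inter> space R)"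
    using event_Collect[OF assms] by (rule measure_distr)
  moreover have "distr R R (\<lambda>\<eta> i. \<eta> (i + m)) = R" using law by (simp add: stationary_renewal_law_def)
  ultimately show ?thesis by (simp only: vimage_Collect_eq space_R Int_UNIV_right)
qed

definition point_density :: real where "point_density = prob {\<eta>. \<eta> 0}"

lemma prob_point: "prob {\<eta>. \<eta> x} = point_density"
proof -
  have "Measurable.pred config_algebra (\<lambda>\<eta> :: int \<Rightarrow> bool. \<eta> 0)" by measurable
  from prob_shift[OF this, of x] show ?thesis by (simp only: point_density_def add_0)
qed

lemma point_event: "{\<eta>. \<eta> x} \<in> events"
  by (rule event_Collect) measurable

text \<open>If the origin were almost surely not a point, then by stationarity no site would be, but the set
  is almost surely nonempty.\<close>

lemma point_density_pos: "0 < point_density"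
proof (rule ccontr)
  assume "\<not> 0 < point_density"
  then have "point_density = 0" using measure_nonneg[of R "{\<eta>. \<eta> 0}"] unfolding point_density_def by linarith
  then have "prob {\<eta>. \<eta> i} = 0" for i by (simp only: prob_point)
  then have "AE \<eta> in R. \<eta> \<notin> {\<eta>. \<eta> i}" for i using prob_eq_0[OF point_event] by blast
  then have "AE \<eta> in R. \<not> \<eta> i" for i by (simp only: mem_Collect_eq)
  then have "AE \<eta> in R. \<forall>i. \<not> \<eta> i" unfolding AE_all_countable by blast
  moreover have "AE \<eta> in R. \<exists>i. \<eta> i" using law by (simp add: stationary_renewal_law_def)
  ultimately have "AE \<eta> in R. False" by eventually_elim blast
  then show False unfolding AE_False by blast
qed

lemma prob_no_point: "prob {\<eta>. \<not> \<eta> x} = 1 - point_density"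
proof -
  have "prob (space R - {\<eta>. \<eta> x}) = 1 - prob {\<eta>. \<eta> x}" by (rule prob_compl[OF point_event])
  then show ?thesis unfolding prob_point space_R by (simp only: set_diff_eq UNIV_I mem_Collect_eq simp_thms)
qed

lemma prob_point_and_gap: "prob {\<eta>. \<eta> 0 \<and> gap 0 \<eta> \<in> B} = point_density * measure (measure_pmf G) B"
proof -
  let ?R0 = "uniform_measure R {\<eta>. \<eta> 0}"
  have meas: "gap 0 \<in> ?R0 \<rightarrow>\<^sub>M count_space UNIV"
    unfolding measurable_cong_sets[OF sets_uniform_measure refl] measurable_cong_sets[OF sets_R refl]
    by (rule measurable_gap)
  have B: "{\<eta>. gap 0 \<eta> \<in> B} \<in> events"
  proof -
    have "gap 0 -` B \<inter> space config_algebra \<in> sets config_algebra"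
      using measurable_gap by (rule measurable_sets) simp
    then show ?thesis by (simp add: vimage_def space_PiM)
  qed
  have pos: "emeasure R {\<eta>. \<eta> 0} \<noteq> 0"
    using point_density_pos by (simp add: emeasure_eq_measure point_density_def)
  have "distr ?R0 (count_space UNIV) (gap 0) = measure_pmf G"
    using law unfolding stationary_renewal_law_def Let_def by blast
  then have "measure (measure_pmf G) B = measure (distr ?R0 (count_space UNIV) (gap 0)) B" by (simp only:)
  also have "\<dots> = measure ?R0 (gap 0 -` B \<inter> space ?R0)"
    using meas by (rule measure_distr) simp
  also have "gap 0 -` B \<inter> space ?R0 = {\<eta>. gap 0 \<eta> \<in> B}"
    by (simp only: space_uniform_measure space_R Int_UNIV_right vimage_def)
  also have "measure ?R0 {\<eta>. gap 0 \<eta> \<in> B} = prob ({\<eta>. \<eta> 0} \<inter> {\<eta>. gap 0 \<eta> \<in> B}) / point_density"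
    unfolding point_density_def by (rule measure_uniform_measure[OF pos _ B]) simp
  also have "{\<eta>. \<eta> 0} \<inter> {\<eta>. gap 0 \<eta> \<in> B} = {\<eta>. \<eta> 0 \<and> gap 0 \<eta> \<in> B}" by (rule Collect_conj_eq[symmetric])
  finally have "measure (measure_pmf G) B = prob {\<eta>. \<eta> 0 \<and> gap 0 \<eta> \<in> B} / point_density" .
  then show ?thesis using point_density_pos
    by (metis less_irrefl nonzero_eq_divide_eq mult.commute)
qed

text \<open>Decompose according to the last point \<open>-m - x\<close> to the left of the window \<open>{-m..m}\<close>. For
  \<open>x \<le> m\<close>, a gap longer than \<open>3 * m\<close> that starts there covers the window, and the events for
  different \<open>x\<close> exclude each other. The number \<open>m\<close> of summands is the effect of size-biasing.\<close>

lemma prob_run_ge: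
  "real m * point_density * measure (measure_pmf G) {3 * m<..} \<le> prob {\<eta>. \<forall>i. \<bar>i\<bar> \<le> int m \<longrightarrow> \<not> \<eta> i}"
proof -
  define E where "E x = {\<eta>. \<eta> (- int m - int x) \<and> 3 * m < gap 0 (\<lambda>i. \<eta> (i + (- int m - int x)))}" for x
  have E_meas: "E x \<in> events" for x
  proof -
    have "Measurable.pred config_algebra (\<lambda>\<eta>. \<eta> 0 \<and> 3 * m < gap 0 \<eta>)" by measurable
    from event_Collect[OF measurable_compose[OF measurable_shift this]] show ?thesis
      unfolding E_def by (simp only: add_0)
  qed
  have prob_E: "prob (E x) = point_density * measure (measure_pmf G) {3 * m<..}" for x
  proof -
    have "Measurable.pred config_algebra (\<lambda>\<eta>. \<eta> 0 \<and> 3 * m < gap 0 \<eta>)" by measurable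
    from prob_shift[OF this, of "- int m - int x"] show ?thesis
      unfolding E_def using prob_point_and_gap[of "{3 * m<..}"] by (simp only: add_0 greaterThan_iff)
  qed
  have free: "\<not> \<eta> i" if "\<eta> \<in> E x" "- int m - int x < i" "i \<le> 2 * int m - int x" for \<eta> i x
    using that gap_0_no_point[of "3 * m" "\<lambda>i. \<eta> (i + (- int m - int x))" "i + int m + int x"]
    by (simp add: E_def)
  have "disjoint_family_on E {1..m}"
    unfolding disjoint_family_on_def
  proof (intro ballI impI)
    fix x y assume xy: "x \<in> {1..m}" "y \<in> {1..m}" "x \<noteq> y"
    have "False" if "\<eta> \<in> E x" "\<eta> \<in> E y" for \<eta>
    proof -
      have "\<eta> (- int m - int x)" "\<eta> (- int m - int y)" using that by (auto simp: E_def)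
      then show False
        using free[OF that(1), of "- int m - int y"] free[OF that(2), of "- int m - int x"] xy
        by (cases "x < y") auto
    qed
    then show "E x \<inter> E y = {}" by blast
  qed
  then have "prob (\<Union>x\<in>{1..m}. E x) = (\<Sum>x\<in>{1..m}. prob (E x))"
    using E_meas by (intro finite_measure_finite_Union) auto
  also have "\<dots> = real m * point_density * measure (measure_pmf G) {3 * m<..}" by (simp add: prob_E)
  finally have "real m * point_density * measure (measure_pmf G) {3 * m<..} = prob (\<Union>x\<in>{1..m}. E x)" by simp
  also have "\<dots> \<le> prob {\<eta>. \<forall>i. \<bar>i\<bar> \<le> int m \<longrightarrow> \<not> \<eta> i}"
  proof (rule finite_measure_mono)
    show "(\<Union>x\<in>{1..m}. E x) \<subseteq> {\<eta>. \<forall>i. \<bar>i\<bar> \<le> int m \<longrightarrow> \<not> \<eta> i}" using free by fastforce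
    show "{\<eta>. \<forall>i. \<bar>i\<bar> \<le> int m \<longrightarrow> \<not> \<eta> i} \<in> events"
      by (rule event_Collect) measurable
  qed
  finally show ?thesis .
qed

text \<open>By stationarity the event that no point lies to the right of \<open>N\<close> has the same probability for all
  \<open>N\<close>, and it shrinks to the event of an empty set as \<open>N\<close> tends to \<open>-\<infinity>\<close>.\<close>

lemma AE_point_to_the_right: "AE \<eta> in R. \<exists>l::nat. \<eta> (N + int l)"
proof -
  define E where "E N = {\<eta>. \<forall>l::nat. \<not> \<eta> (N + int l)}" for N :: int
  have E_meas: "E N \<in> events" for N
    unfolding E_def by (rule event_Collect) measurable
  have E_const: "prob (E N) = prob (E 0)" for N
  proof -
    have "Measurable.pred config_algebra (\<lambda>\<eta>. \<forall>l::nat. \<not> \<eta> (int l))" by measurable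
    from prob_shift[OF this, of N] show ?thesis unfolding E_def by (simp only: add_0 add.commute)
  qed
  have "(\<lambda>n. prob (E (- int n))) \<longlonglongrightarrow> prob (\<Inter>n. E (- int n))"
  proof (rule finite_Lim_measure_decseq)
    show "decseq (\<lambda>n. E (- int n))"
    proof (rule decseq_SucI, rule subsetI)
      fix n \<eta> assume *: "\<eta> \<in> E (- int (Suc n))"
      have "\<not> \<eta> (- int n + int l)" for l
      proof -
        have "\<not> \<eta> (- int (Suc n) + int (Suc l))" using * unfolding E_def by blast
        then show ?thesis by simp
      qed
      then show "\<eta> \<in> E (- int n)" by (simp add: E_def)
    qed
  qed (use E_meas in auto)
  moreover have "(\<lambda>n. prob (E (- int n))) = (\<lambda>n. prob (E 0))"
    using E_const by (intro ext)
  ultimately have eq: "prob (E 0) = prob (\<Inter>n. E (- int n))" by (simp only: LIMSEQ_const_iff)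
  have sub: "(\<Inter>n. E (- int n)) \<subseteq> {\<eta>. \<forall>i. \<not> \<eta> i}"
  proof (rule subsetI, unfold mem_Collect_eq, rule allI)
    fix \<eta> i assume *: "\<eta> \<in> (\<Inter>n. E (- int n))"
    then have "\<eta> \<in> E (- int (nat \<bar>i\<bar>))" by blast
    then have "\<not> \<eta> (- int (nat \<bar>i\<bar>) + int (nat (i + \<bar>i\<bar>)))" unfolding E_def by blast
    moreover have "- int (nat \<bar>i\<bar>) + int (nat (i + \<bar>i\<bar>)) = i"
    proof -
      have "0 \<le> i + \<bar>i\<bar>" by linarith
      then show ?thesis by simp
    qed
    ultimately show "\<not> \<eta> i" by (simp only: not_False_eq_True)
  qed
  have empty: "{\<eta>. \<forall>i. \<not> \<eta> i} \<in> events" by (rule event_Collect) measurable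
  have "AE \<eta> in R. \<exists>i. \<eta> i" using law unfolding stationary_renewal_law_def by blast
  then have "AE \<eta> in R. \<eta> \<notin> {\<eta>. \<forall>i. \<not> \<eta> i}" by (simp only: mem_Collect_eq not_all not_not)
  then have "prob {\<eta>. \<forall>i. \<not> \<eta> i} = 0" using prob_eq_0[OF empty] by blast
  then have "prob (E N) = 0"
    using finite_measure_mono[OF sub empty] eq E_const[of N] measure_nonneg[of R "E 0"] by linarith
  then have "AE \<eta> in R. \<eta> \<notin> E N" using prob_eq_0[OF E_meas] by blast
  then show ?thesis by (simp add: E_def)
qed

sublocale field: product_prob_space "\<lambda>_::nat. R" UNIV
  by unfold_locales

sublocale env: prob_space "obstacle_field_law R"
  unfolding obstacle_field_law_def by (rule field.P.prob_space_axioms)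

lemma sets_env [measurable_cong]:
  "sets (obstacle_field_law R) = sets (PiM UNIV (\<lambda>_::nat. config_algebra))"
  unfolding obstacle_field_law_def by (rule sets_PiM_cong) auto

lemma space_env [simp]: "space (obstacle_field_law R) = UNIV"
  by (auto simp: obstacle_field_law_def space_PiM)

lemma env_event_Collect:
  assumes "Measurable.pred (PiM UNIV (\<lambda>_::nat. config_algebra)) P"
  shows "{\<omega>. P \<omega>} \<in> env.events"
proof -
  have "space (PiM UNIV (\<lambda>_::nat. config_algebra :: (int \<Rightarrow> bool) measure)) = UNIV" by (simp add: space_PiM)
  with assms show ?thesis unfolding pred_def sets_env by (simp only: UNIV_I simp_thms)
qed

lemma env_rows_event:
  assumes "finite J" "\<And>j. j \<in> J \<Longrightarrow> A j \<in> events"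
  shows "{\<omega>. \<forall>j\<in>J. \<omega> j \<in> A j} \<in> env.events"
proof (rule env_event_Collect, rule pred_intros_finite(3)[OF assms(1)])
  fix j assume "j \<in> J"
  then have "A j \<in> sets config_algebra" using assms(2) sets_R by blast
  then show "Measurable.pred (PiM UNIV (\<lambda>_::nat. config_algebra)) (\<lambda>\<omega>. \<omega> j \<in> A j)"
    by (rule pred_sets2) (rule measurable_component_singleton, simp)
qed

lemma env_prob_rows:
  assumes "finite J" "\<And>j. j \<in> J \<Longrightarrow> A j \<in> sets R"
  shows "env.prob {\<omega>. \<forall>j\<in>J. \<omega> j \<in> A j} = (\<Prod>j\<in>J. prob (A j))"
proof -
  have "emeasure (obstacle_field_law R) {\<omega>. \<forall>j\<in>J. \<omega> j \<in> A j} = (\<Prod>j\<in>J. emeasure R (A j))"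
    using field.emeasure_PiM_Collect[of J A] assms by (simp add: obstacle_field_law_def space_PiM)
  then show ?thesis
    by (simp add: env.emeasure_eq_measure emeasure_eq_measure prod_ennreal measure_nonneg prod_nonneg)
qed

text \<open>A horizontal ray would be a half-line without points. A ray of slope \<open>m > 0\<close> meets each row at
  most once, so the events that it meets obstacles there are independent, each of
  probability less than 1.\<close>

lemma AE_no_obstacle_ray: "AE \<omega> in obstacle_field_law R. \<not> obstacle_ray \<omega> N j m"
proof (cases "m = 0")
  case True
  have "AE \<omega> in obstacle_field_law R. \<exists>l::nat. \<omega> j (N + int l)"
    unfolding obstacle_field_law_def by (rule field.AE_component) (auto intro: AE_point_to_the_right)
  then show ?thesis by (simp add: obstacle_ray_def True)
next
  case False
  define X where "X = {\<omega>. obstacle_ray \<omega> N j m}"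
  have X_meas: "X \<in> env.events"
  proof -
    have [measurable]: "Measurable.pred (PiM UNIV (\<lambda>_::nat. config_algebra)) (\<lambda>\<omega>. \<omega> r i)" for r and i :: int
      by (rule measurable_compose[where f = "\<lambda>\<omega>. \<omega> r" and g = "\<lambda>\<eta>. \<eta> i",
            OF measurable_component_singleton measurable_component_singleton]) simp_all
    show ?thesis unfolding X_def obstacle_ray_def by (rule env_event_Collect) measurable
  qed
  have le: "env.prob X \<le> (1 - point_density) ^ n" for n
  proof -
    define J where "J = (\<lambda>l. j + m * l) ` {..<n}"
    define A where "A r = {\<eta>. \<not> \<eta> (N + int ((r - j) div m))}" for r
    have A_meas: "A r \<in> events" for r
      unfolding A_def by (rule event_Collect) measurable
    have X_sub: "X \<subseteq> {\<omega>. \<forall>r\<in>J. \<omega> r \<in> A r}"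
      using False by (auto simp: X_def obstacle_ray_def J_def A_def)
    have "{\<omega>. \<forall>r\<in>J. \<omega> r \<in> A r} \<in> env.events"
      using A_meas by (intro env_rows_event) (auto simp: J_def)
    then have "env.prob X \<le> env.prob {\<omega>. \<forall>r\<in>J. \<omega> r \<in> A r}"
      using X_sub by (intro env.finite_measure_mono)
    also have "\<dots> = (\<Prod>r\<in>J. prob (A r))" using A_meas by (intro env_prob_rows) (auto simp: J_def)
    also have "\<dots> = (1 - point_density) ^ card J" by (simp add: A_def prob_no_point)
    also have "card J = n" unfolding J_def using False by (subst card_image) (auto simp: inj_on_def)
    finally show ?thesis .
  qed
  have "(\<lambda>n. (1 - point_density) ^ n) \<longlonglongrightarrow> 0"
  proof (rule LIMSEQ_realpow_zero)
    show "0 \<le> 1 - point_density" unfolding point_density_def by simp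
  qed (use point_density_pos in simp)
  then have "env.prob X \<le> 0" by (rule LIMSEQ_le_const) (use le in blast)
  then have "env.prob X = 0" using measure_nonneg[of "obstacle_field_law R" X] by linarith
  then have "AE \<omega> in obstacle_field_law R. \<omega> \<notin> X" using env.prob_eq_0[OF X_meas] by blast
  then show ?thesis by (simp add: X_def)
qed

text \<open>By \<open>prob_run_ge\<close> a given row has the run of length \<open>4^k\<close> with probability at least a constant times
  \<open>(4/5)^k\<close>. Among \<open>2^k\<close> independent rows the expected number of runs is at least a
  constant times \<open>(8/5)^k\<close>, so the probability of having none is summable.\<close>

lemma AE_long_runs:
  assumes c: "0 < c" and tail: "\<And>k. c * (1 / 5) ^ k \<le> measure (measure_pmf G) {3 * 4 ^ k<..}"
  shows "AE \<omega> in obstacle_field_law R.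
    \<forall>\<^sub>F k in sequentially. \<exists>j<2^k. \<forall>i. \<bar>i\<bar> \<le> 4^k \<longrightarrow> \<not> \<omega> j i"
proof -
  define run where "run k = {\<eta> :: int \<Rightarrow> bool. \<forall>i. \<bar>i\<bar> \<le> 4^k \<longrightarrow> \<not> \<eta> i}" for k :: nat
  define bad where "bad k = {\<omega>. \<forall>j\<in>{..<(2::nat)^k}. \<omega> j \<in> UNIV - run k}" for k :: nat
  have run_meas: "run k \<in> events" for k
    unfolding run_def by (rule event_Collect) measurable
  have bad_meas: "bad k \<in> env.events" for k
    unfolding bad_def using sets.compl_sets[OF run_meas[of k]] by (intro env_rows_event) auto
  have prob_run: "c * point_density * (4 / 5) ^ k \<le> prob (run k)" for k
  proof -
    have "c * point_density * (4 / 5) ^ k = 4 ^ k * point_density * (c * (1 / 5) ^ k)"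
      by (simp add: power_divide)
    also have "\<dots> \<le> 4 ^ k * point_density * measure (measure_pmf G) {3 * 4 ^ k<..}"
      using point_density_pos tail by (intro mult_left_mono) auto
    also have "\<dots> \<le> prob (run k)" using prob_run_ge[of "4 ^ k"] by (simp add: run_def)
    finally show ?thesis .
  qed
  have prob_bad: "env.prob (bad k) \<le> 1 / (c * point_density) * (5 / 8) ^ k" for k
  proof -
    let ?p = "prob (run k)"
    have "env.prob (bad k) = (\<Prod>j\<in>{..<(2::nat)^k}. prob (UNIV - run k))"
      unfolding bad_def using run_meas[of k] sets.compl_sets[OF run_meas[of k]] by (intro env_prob_rows) auto
    also have "\<dots> = (1 - ?p) ^ (2 ^ k)" using prob_compl[OF run_meas[of k]] by simp
    also have "\<dots> \<le> exp (- ?p) ^ (2 ^ k)"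
      using exp_ge_add_one_self[of "- ?p"] by (intro power_mono) auto
    also have "\<dots> = 1 / exp (2 ^ k * ?p)" by (simp add: exp_minus inverse_eq_divide power_one_over flip: exp_of_nat_mult)
    also have "\<dots> \<le> 1 / (2 ^ k * (c * point_density * (4 / 5) ^ k))"
    proof (rule divide_left_mono)
      have "2 ^ k * (c * point_density * (4 / 5) ^ k) \<le> 2 ^ k * ?p" using prob_run by (intro mult_left_mono) auto
      also have "\<dots> \<le> exp (2 ^ k * ?p)" using exp_ge_add_one_self[of "2 ^ k * ?p"] by linarith
      finally show "2 ^ k * (c * point_density * (4 / 5) ^ k) \<le> exp (2 ^ k * ?p)" .
    qed (use c point_density_pos in auto)
    also have "\<dots> = 1 / (c * point_density) * (5 / 8) ^ k"
    proof -
      have "(2::real) ^ k * (4 / 5) ^ k = (8 / 5) ^ k" by (simp flip: power_mult_distrib)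
      moreover have "1 / (8 / 5 :: real) ^ k = (5 / 8) ^ k" by (simp add: power_divide)
      ultimately show ?thesis by (simp add: field_simps)
    qed
    finally show ?thesis .
  qed
  have "summable (\<lambda>k. env.prob (bad k))"
  proof (rule summable_comparison_test')
    show "summable (\<lambda>k. 1 / (c * point_density) * (5 / 8) ^ k)" by (intro summable_mult summable_geometric) simp
    show "norm (env.prob (bad k)) \<le> 1 / (c * point_density) * (5 / 8) ^ k" if "0 \<le> k" for k
      using prob_bad[of k] by simp
  qed
  then have "AE \<omega> in obstacle_field_law R. \<forall>\<^sub>F k in sequentially. \<omega> \<in> space (obstacle_field_law R) - bad k"
    using bad_meas by (intro borel_cantelli_AE1) (auto simp: env.emeasure_eq_measure)
  then show ?thesis
    by eventually_elim (auto simp: bad_def run_def elim!: eventually_mono)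
qed

end

section \<open>Existence of the stationary renewal process\<close>

text \<open>Replacing the gap 0 by 1 makes the enumeration strictly increasing for every sequence of gaps, and
  not only for almost every one.\<close>

definition renewal_point :: "(int \<Rightarrow> nat) \<Rightarrow> int \<Rightarrow> int" where
  "renewal_point g k =
     (if 0 \<le> k then (\<Sum>i\<in>{0..<k}. int (max 1 (g i))) else - (\<Sum>i\<in>{k..<0}. int (max 1 (g i))))"

definition renewal_set :: "(int \<Rightarrow> nat) \<Rightarrow> int \<Rightarrow> bool" where
  "renewal_set g x \<longleftrightarrow> (\<exists>k. x = renewal_point g k)"

lemma renewal_point_0: "renewal_point g 0 = 0"
  by (simp add: renewal_point_def)

lemma renewal_point_Suc: "renewal_point g (k + 1) = renewal_point g k + int (max 1 (g k))"
proof (cases "0 \<le> k")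
  case True
  then have "{0..<k + 1} = insert k {0..<k}" by auto
  then show ?thesis using True by (simp add: renewal_point_def)
next
  case False
  then have "{k..<0} = insert k {k + 1..<0}" by auto
  moreover have "{k + 1..<0} = {}" if "0 \<le> k + 1" using that by simp
  ultimately show ?thesis using False by (auto simp: renewal_point_def)
qed

lemma renewal_point_strict_mono: "strict_mono (renewal_point g)"
proof (rule strict_monoI)
  fix k l :: int assume "k < l"
  have "renewal_point g k < renewal_point g (k + 1 + int n)" for n
  proof (induction n)
    case 0
    then show ?case using renewal_point_Suc[of g k] by simp
  next
    case (Suc n)
    then show ?case using renewal_point_Suc[of g "k + 1 + int n"] by (simp add: algebra_simps)
  qed
  from this[of "nat (l - k - 1)"] show "renewal_point g k < renewal_point g l" using \<open>k < l\<close> by simp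
qed

lemma no_renewal_between:
  assumes "renewal_point g k < x" "x < renewal_point g (k + 1)"
  shows "\<not> renewal_set g x"
proof
  assume "renewal_set g x"
  then obtain l where "x = renewal_point g l" by (auto simp: renewal_set_def)
  then have "k < l" "l < k + 1"
    using assms by (simp_all add: strict_mono_less[OF renewal_point_strict_mono])
  then show False by simp
qed

lemma next_point_renewal: "next_point (renewal_set g) (renewal_point g k) = renewal_point g (k + 1)"
proof -
  let ?d = "max 1 (g k)"
  have "(LEAST n. 0 < n \<and> renewal_set g (renewal_point g k + int n)) = ?d"
  proof (rule Least_equality)
    show "0 < ?d \<and> renewal_set g (renewal_point g k + int ?d)"
      unfolding renewal_set_def by (auto intro!: exI[of _ "k + 1"] simp: renewal_point_Suc)
    fix n assume n: "0 < n \<and> renewal_set g (renewal_point g k + int n)"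
    then have "\<not> renewal_point g k + int n < renewal_point g (k + 1)"
      using no_renewal_between[of g k "renewal_point g k + int n"] by auto
    then show "?d \<le> n" unfolding renewal_point_Suc by linarith
  qed
  then show ?thesis by (simp only: next_point_def renewal_point_Suc)
qed

lemma prev_point_renewal: "prev_point (renewal_set g) (renewal_point g (k + 1)) = renewal_point g k"
proof -
  let ?d = "max 1 (g k)"
  have "(LEAST n. 0 < n \<and> renewal_set g (renewal_point g (k + 1) - int n)) = ?d"
  proof (rule Least_equality)
    show "0 < ?d \<and> renewal_set g (renewal_point g (k + 1) - int ?d)"
      unfolding renewal_set_def by (auto intro!: exI[of _ k] simp: renewal_point_Suc)
    fix n assume n: "0 < n \<and> renewal_set g (renewal_point g (k + 1) - int n)"
    then have "\<not> renewal_point g k < renewal_point g (k + 1) - int n"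
      using no_renewal_between[of g k "renewal_point g (k + 1) - int n"] by auto
    then show "?d \<le> n" unfolding renewal_point_Suc by linarith
  qed
  then show ?thesis by (simp only: prev_point_def renewal_point_Suc add_diff_cancel_right')
qed

lemma nth_point_renewal: "nth_point (renewal_set g) k = renewal_point g k"
proof -
  have forward: "(next_point (renewal_set g) ^^ n) 0 = renewal_point g (int n)" for n
  proof (induction n)
    case (Suc n)
    then show ?case using next_point_renewal[of g "int n"] by (simp add: add.commute)
  qed (simp add: renewal_point_0)
  have backward: "(prev_point (renewal_set g) ^^ n) 0 = renewal_point g (- int n)" for n
  proof (induction n)
    case (Suc n)
    then show ?case using prev_point_renewal[of g "- 1 - int n"] by simp
  qed (simp add: renewal_point_0)
  show ?thesis
  proof (cases "0 \<le> k")
    case True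
    then show ?thesis using forward[of "nat k"] by (simp add: nth_point_def)
  next
    case False
    then show ?thesis using backward[of "nat (- k)"] by (simp add: nth_point_def)
  qed
qed

lemma gap_renewal: "gap k (renewal_set g) = max 1 (g k)"
  by (simp only: gap_def nth_point_renewal renewal_point_Suc add_diff_cancel_left' nat_int)

text \<open>Shifting the sequence of gaps by one index amounts to looking at the set from its next point. This is
  how the shift invariance of the gaps enters the stationarity of the point process.\<close>

lemma renewal_set_shift: "renewal_set (\<lambda>i. g (i + 1)) x = renewal_set g (x + int (max 1 (g 0)))"
proof -
  have "renewal_point (\<lambda>i. g (i + 1)) k = renewal_point g (k + 1) - int (max 1 (g 0))" for k
  proof (induction k rule: int_induct[where k = 0])
    case base
    then show ?case using renewal_point_Suc[of g 0] by (simp add: renewal_point_0)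
  next
    case (step1 k)
    then show ?case using renewal_point_Suc[of g "k + 1"] renewal_point_Suc[of "\<lambda>i. g (i + 1)" k] by simp
  next
    case (step2 k)
    then show ?case using renewal_point_Suc[of g k] renewal_point_Suc[of "\<lambda>i. g (i + 1)" "k - 1"] by simp
  qed
  then have "x = renewal_point (\<lambda>i. g (i + 1)) k \<longleftrightarrow> x + int (max 1 (g 0)) = renewal_point g (k + 1)" for k
    using eq_diff_eq[of x "renewal_point g (k + 1)" "int (max 1 (g 0))"] by presburger
  then have "renewal_set (\<lambda>i. g (i + 1)) x \<longleftrightarrow> (\<exists>k. x + int (max 1 (g 0)) = renewal_point g (k + 1))"
    unfolding renewal_set_def by (simp only:)
  also have "\<dots> \<longleftrightarrow> renewal_set g (x + int (max 1 (g 0)))"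
  proof
    assume "renewal_set g (x + int (max 1 (g 0)))"
    then obtain k where "x + int (max 1 (g 0)) = renewal_point g k" unfolding renewal_set_def by blast
    then have "x + int (max 1 (g 0)) = renewal_point g (k - 1 + 1)" by (simp only: diff_add_cancel)
    then show "\<exists>k. x + int (max 1 (g 0)) = renewal_point g (k + 1)" by blast
  qed (unfold renewal_set_def, blast)
  finally show ?thesis .
qed

lemma renewal_set_0: "renewal_set g 0"
  unfolding renewal_set_def by (rule exI[of _ 0]) (simp only: renewal_point_0)

abbreviation gap_algebra :: "(int \<Rightarrow> nat) measure" where
  "gap_algebra \<equiv> PiM UNIV (\<lambda>_. count_space UNIV)"

lemma measurable_renewal_point:
  "(\<lambda>g. renewal_point g k) \<in> gap_algebra \<rightarrow>\<^sub>M count_space UNIV"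
proof -
  have coord: "(\<lambda>g. int (max 1 (g i))) \<in> gap_algebra \<rightarrow>\<^sub>M count_space UNIV" for i
    by (rule measurable_compose[OF measurable_component_singleton[of i UNIV]]) auto
  have "(\<lambda>g. \<Sum>i\<in>I. int (max 1 (g i))) \<in> gap_algebra \<rightarrow>\<^sub>M count_space UNIV" if "finite I" for I
    using that
  proof (induction I rule: finite_induct)
    case (insert i I)
    have "(\<lambda>g. (\<lambda>a. a + (\<Sum>i\<in>I. int (max 1 (g i)))) (int (max 1 (g i)))) \<in> gap_algebra \<rightarrow>\<^sub>M count_space UNIV"
    proof (rule measurable_compose_countable[OF _ coord])
      fix a
      show "(\<lambda>g. a + (\<Sum>i\<in>I. int (max 1 (g i)))) \<in> gap_algebra \<rightarrow>\<^sub>M count_space UNIV"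
        by (rule measurable_compose[OF insert.IH]) auto
    qed
    then show ?case using insert.hyps by simp
  qed simp
  note sum = this
  show ?thesis
  proof (cases "0 \<le> k")
    case True
    then show ?thesis using sum[of "{0..<k}"] by (simp add: renewal_point_def)
  next
    case False
    have "(\<lambda>g. - (\<Sum>i\<in>{k..<0}. int (max 1 (g i)))) \<in> gap_algebra \<rightarrow>\<^sub>M count_space UNIV"
      by (rule measurable_compose[OF sum[of "{k..<0}"]]) auto
    then show ?thesis using False by (simp add: renewal_point_def)
  qed
qed

lemma measurable_renewal_set:
  "(\<lambda>g. renewal_set g x) \<in> gap_algebra \<rightarrow>\<^sub>M count_space UNIV"
proof -
  have "Measurable.pred gap_algebra (\<lambda>g. x = renewal_point g k)" for k
    by (rule measurable_compose[OF measurable_renewal_point[of k]]) auto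
  then show ?thesis unfolding renewal_set_def by (rule pred_intros_countable(2))
qed

lemma measurable_shifted_renewal_set:
  "(\<lambda>g i. renewal_set g (i + m)) \<in> gap_algebra \<rightarrow>\<^sub>M config_algebra"
  by (rule measurable_PiM_single') (auto intro: measurable_renewal_set)

context
  fixes G :: "nat pmf"
  assumes integrable_G: "integrable (measure_pmf G) real"
begin

definition gaps_measure :: "(int \<Rightarrow> nat) measure" where
  "gaps_measure = PiM UNIV (\<lambda>_. measure_pmf G)"

lemma sets_gaps: "sets gaps_measure = sets gap_algebra"
  unfolding gaps_measure_def by (rule sets_PiM_cong) auto

interpretation gaps: prob_space gaps_measure
  unfolding gaps_measure_def by (rule prob_space_PiM) (rule prob_space_measure_pmf)

lemma measurable_gaps: "f \<in> gap_algebra \<rightarrow>\<^sub>M M \<Longrightarrow> f \<in> gaps_measure \<rightarrow>\<^sub>M M"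
  unfolding measurable_cong_sets[OF sets_gaps refl] .

lemma distr_gaps_component: "distr gaps_measure (count_space UNIV) (\<lambda>g. g k) = measure_pmf G"
proof -
  have "distr gaps_measure (measure_pmf G) (\<lambda>g. g k) = measure_pmf G"
    unfolding gaps_measure_def by (rule distr_PiM_component) (auto intro: prob_space_measure_pmf)
  moreover have "distr gaps_measure (measure_pmf G) (\<lambda>g. g k) = distr gaps_measure (count_space UNIV) (\<lambda>g. g k)"
    by (rule distr_cong) auto
  ultimately show ?thesis by simp
qed

lemma distr_gaps_shift: "distr gaps_measure gaps_measure (\<lambda>g i. g (i + 1)) = gaps_measure"
proof -
  have "distr (PiM UNIV (\<lambda>_::int. measure_pmf G)) (PiM UNIV (\<lambda>_::int. measure_pmf G)) (\<lambda>\<omega>. \<lambda>n\<in>UNIV. \<omega> (n + 1))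
      = PiM UNIV (\<lambda>_::int. measure_pmf G)"
    by (rule distr_PiM_reindex) (auto intro: prob_space_measure_pmf)
  then show ?thesis unfolding gaps_measure_def restrict_UNIV .
qed

lemma measurable_hit:
  assumes "A \<in> sets config_algebra"
  shows "(\<lambda>g. indicator A (\<lambda>i. renewal_set g (i + m)) :: ennreal) \<in> borel_measurable gaps_measure"
  by (rule measurable_compose[OF measurable_gaps[OF measurable_shifted_renewal_set[of m]] borel_measurable_indicator[OF assms]])

definition mean_gap :: ennreal where
  "mean_gap = (\<integral>\<^sup>+ g. ennreal (real (max 1 (g 0))) \<partial>gaps_measure)"

lemma measurable_first_gap: "(\<lambda>g. max 1 (g 0)) \<in> gaps_measure \<rightarrow>\<^sub>M count_space UNIV"
  by (intro measurable_gaps measurable_compose[OF measurable_component_singleton[of 0 UNIV]]) auto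

lemma measurable_sum_first_gap:
  fixes c :: "nat \<Rightarrow> (int \<Rightarrow> nat) \<Rightarrow> ennreal"
  assumes "\<And>k. c k \<in> borel_measurable gaps_measure"
  shows "(\<lambda>g. \<Sum>k<max 1 (g 0). c k g) \<in> borel_measurable gaps_measure"
proof (rule measurable_compose_countable[where f = "\<lambda>n g. \<Sum>k<n. c k g", OF _ measurable_first_gap])
  fix n :: nat
  show "(\<lambda>g. \<Sum>k<n. c k g) \<in> borel_measurable gaps_measure"
    by (rule borel_measurable_sum) (rule assms)
qed

lemma mean_gap_bounds: "mean_gap \<noteq> 0" "mean_gap \<noteq> \<infinity>"
proof -
  have "(1::ennreal) = (\<integral>\<^sup>+ g. 1 \<partial>gaps_measure)" using gaps.emeasure_space_1 by simp
  also have "\<dots> \<le> mean_gap" unfolding mean_gap_def by (intro nn_integral_mono) (simp flip: ennreal_1)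
  finally show "mean_gap \<noteq> 0" by auto
  have "mean_gap = (\<integral>\<^sup>+ n. ennreal (real (max 1 n)) \<partial>distr gaps_measure (count_space UNIV) (\<lambda>g. g 0))"
    unfolding mean_gap_def
    by (subst nn_integral_distr) (auto intro: measurable_gaps measurable_component_singleton)
  also have "\<dots> \<le> (\<integral>\<^sup>+ n. 1 + ennreal (real n) \<partial>measure_pmf G)"
    unfolding distr_gaps_component
  proof (intro nn_integral_mono)
    fix n :: nat
    have "ennreal (real (max 1 n)) \<le> ennreal (1 + real n)" by (intro ennreal_leI) auto
    then show "ennreal (real (max 1 n)) \<le> 1 + ennreal (real n)" by (simp add: ennreal_plus)
  qed
  also have "\<dots> = 1 + (\<integral>\<^sup>+ n. ennreal (real n) \<partial>measure_pmf G)"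
    by (subst nn_integral_add) auto
  also have "\<dots> < \<infinity>"
    using integrable_G unfolding integrable_iff_bounded by (simp add: ennreal_add_eq_top less_top)
  finally show "mean_gap \<noteq> \<infinity>" by simp
qed

text \<open>Palm inversion: the law of the renewal set seen from a site \<open>k\<close> that is drawn uniformly from the gap
  after the origin, where the gaps are biased by the length of this gap.\<close>

definition palm_inverse :: "(int \<Rightarrow> bool) measure" where
  "palm_inverse = distr
     (density (gaps_measure \<Otimes>\<^sub>M count_space UNIV)
       (\<lambda>(g, k). indicator {k::nat. k < max 1 (g 0)} k / mean_gap))
     config_algebra (\<lambda>(g, k) i. renewal_set g (i + int k))"

lemma sets_palm_inverse: "sets palm_inverse = sets config_algebra"
  by (simp add: palm_inverse_def)

lemma emeasure_palm_inverse:
  assumes A: "A \<in> sets config_algebra"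
  shows "emeasure palm_inverse A =
    (\<integral>\<^sup>+ g. (\<Sum>k<max 1 (g 0). indicator A (\<lambda>i. renewal_set g (i + int k))) \<partial>gaps_measure) / mean_gap"
proof -
  let ?P = "gaps_measure \<Otimes>\<^sub>M count_space (UNIV :: nat set)"
  define h where "h = (\<lambda>(g, k) i. renewal_set g (i + int k))"
  define f where "f = (\<lambda>(g :: int \<Rightarrow> nat, k::nat). indicator {k. k < max 1 (g 0)} k / mean_gap :: ennreal)"
  have h: "h \<in> ?P \<rightarrow>\<^sub>M config_algebra"
    unfolding h_def case_prod_beta
  proof (rule measurable_compose_countable[where f = "\<lambda>k x i. renewal_set (fst x) (i + int k)" and g = snd])
    fix k :: nat
    show "(\<lambda>x i. renewal_set (fst x) (i + int k)) \<in> ?P \<rightarrow>\<^sub>M config_algebra"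
      by (rule measurable_compose[OF measurable_fst measurable_gaps[OF measurable_shifted_renewal_set]])
  qed simp
  have f: "f \<in> borel_measurable ?P"
    unfolding f_def case_prod_beta
  proof (rule measurable_compose_countable[where g = snd and f = "\<lambda>k x. indicator {k. k < max 1 (fst x 0)} k / mean_gap"])
    fix k :: nat
    show "(\<lambda>x. indicator {k. k < max 1 (fst x 0)} k / mean_gap) \<in> borel_measurable ?P"
      by (rule measurable_compose[where g = "\<lambda>n. indicator {k. k < n} k / mean_gap",
            OF measurable_compose[OF measurable_fst measurable_first_gap] borel_measurable_count_space])
  qed simp
  have hA: "h -` A \<inter> space ?P \<in> sets ?P" using h A by (rule measurable_sets)
  have "emeasure palm_inverse A = emeasure (density ?P f) (h -` A \<inter> space ?P)"
    unfolding palm_inverse_def f_def[symmetric] h_def[symmetric]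
  proof (subst emeasure_distr[OF _ A])
    show "h \<in> density ?P f \<rightarrow>\<^sub>M config_algebra"
      unfolding measurable_cong_sets[OF sets_density refl] by (rule h)
  qed (simp only: space_density)
  also have "\<dots> = (\<integral>\<^sup>+ x. f x * indicator (h -` A \<inter> space ?P) x \<partial>?P)"
    by (rule emeasure_density[OF f hA])
  also have "\<dots> = (\<integral>\<^sup>+ x. f x * indicator A (h x) \<partial>?P)"
  proof (rule nn_integral_cong)
    fix x assume "x \<in> space ?P"
    then have "indicator (h -` A \<inter> space ?P) x = (indicator A (h x) :: ennreal)" by (simp only: indicator_def Int_iff vimage_eq simp_thms)
    then show "f x * indicator (h -` A \<inter> space ?P) x = f x * indicator A (h x)" by (simp only:)
  qed
  also have "\<dots> = (\<integral>\<^sup>+ g. \<integral>\<^sup>+ k. f (g, k) * indicator A (h (g, k)) \<partial>count_space UNIV \<partial>gaps_measure)"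
  proof (rule sigma_finite_measure.nn_integral_fst[symmetric])
    show "sigma_finite_measure (count_space (UNIV :: nat set))"
      by (rule sigma_finite_measure_count_space)
    show "(\<lambda>x. f x * indicator A (h x)) \<in> borel_measurable ?P"
      using f measurable_compose[OF h borel_measurable_indicator[OF A]] by (rule borel_measurable_times_ennreal)
  qed
  also have "\<dots> = (\<integral>\<^sup>+ g. (\<Sum>k<max 1 (g 0). indicator A (\<lambda>i. renewal_set g (i + int k))) / mean_gap \<partial>gaps_measure)"
  proof (rule nn_integral_cong)
    fix g :: "int \<Rightarrow> nat"
    have "(\<integral>\<^sup>+ k. f (g, k) * indicator A (h (g, k)) \<partial>count_space UNIV) = (\<Sum>k<max 1 (g 0). f (g, k) * indicator A (h (g, k)))"
    proof (rule nn_integral_count_space')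
      fix k assume "k \<notin> {..<max 1 (g 0)}"
      then have "f (g, k) = 0" by (simp add: f_def)
      then show "f (g, k) * indicator A (h (g, k)) = 0" by (simp only: mult_zero_left)
    qed auto
    also have "\<dots> = (\<Sum>k<max 1 (g 0). indicator A (\<lambda>i. renewal_set g (i + int k)) * (1 / mean_gap))"
    proof (rule sum.cong)
      fix k assume "k \<in> {..<max 1 (g 0)}"
      then have "f (g, k) = 1 / mean_gap" by (simp add: f_def)
      then show "f (g, k) * indicator A (h (g, k)) = indicator A (\<lambda>i. renewal_set g (i + int k)) * (1 / mean_gap)"
        by (simp only: h_def case_prod_conv mult.commute)
    qed (rule refl)
    also have "\<dots> = (\<Sum>k<max 1 (g 0). indicator A (\<lambda>i. renewal_set g (i + int k))) * (1 / mean_gap)"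
      by (rule sum_distrib_right[symmetric])
    also have "\<dots> = (\<Sum>k<max 1 (g 0). indicator A (\<lambda>i. renewal_set g (i + int k))) / mean_gap"
      by (simp only: ennreal_times_divide mult_1_right)
    finally show "(\<integral>\<^sup>+ k. f (g, k) * indicator A (h (g, k)) \<partial>count_space UNIV)
        = (\<Sum>k<max 1 (g 0). indicator A (\<lambda>i. renewal_set g (i + int k))) / mean_gap" .
  qed
  also have "\<dots> = (\<integral>\<^sup>+ g. (\<Sum>k<max 1 (g 0). indicator A (\<lambda>i. renewal_set g (i + int k))) \<partial>gaps_measure) / mean_gap"
  proof (rule nn_integral_divide)
    show "(\<lambda>g. \<Sum>k<max 1 (g 0). indicator A (\<lambda>i. renewal_set g (i + int k)) :: ennreal) \<in> borel_measurable gaps_measure"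
      by (rule measurable_sum_first_gap) (rule measurable_hit[OF A])
  qed
  finally show ?thesis .
qed

lemma space_palm_inverse: "space palm_inverse = UNIV"
  unfolding palm_inverse_def space_distr by (rule space_config)

lemma prob_space_palm_inverse: "prob_space palm_inverse"
proof
  have "(\<integral>\<^sup>+ g. (\<Sum>k<max 1 (g 0). indicator UNIV (\<lambda>i. renewal_set g (i + int k))) \<partial>gaps_measure) = mean_gap"
  proof -
    have "(\<Sum>k<n. 1) = ennreal (real n)" for n :: nat
      by (simp only: sum_constant card_lessThan mult_1_right ennreal_of_nat_eq_real_of_nat)
    then show ?thesis unfolding mean_gap_def indicator_UNIV by (simp only:)
  qed
  moreover have "mean_gap / mean_gap = 1"
    using mean_gap_bounds by (intro ennreal_divide_self) (simp_all add: less_top)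
  ultimately show "emeasure palm_inverse (space palm_inverse) = 1"
    unfolding space_palm_inverse emeasure_palm_inverse[OF UNIV_config] by (simp only:)
qed

lemma emeasure_first_renewal_set:
  assumes A: "A \<in> sets config_algebra"
  shows "(\<integral>\<^sup>+ g. indicator A (renewal_set g) \<partial>gaps_measure) = emeasure (distr gaps_measure config_algebra renewal_set) A"
proof -
  have meas: "renewal_set \<in> gaps_measure \<rightarrow>\<^sub>M config_algebra"
    using measurable_gaps[OF measurable_shifted_renewal_set[of 0]] by simp
  have "(\<integral>\<^sup>+ x. indicator A x \<partial>distr gaps_measure config_algebra renewal_set) = (\<integral>\<^sup>+ g. indicator A (renewal_set g) \<partial>gaps_measure)"
    by (rule nn_integral_distr[OF meas]) (rule borel_measurable_indicator, simp only: sets_distr A)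
  then show ?thesis using nn_integral_indicator[of A "distr gaps_measure config_algebra renewal_set"] A
    by (simp only: sets_distr)
qed

text \<open>A shift by 1 replaces the sum over \<open>k < g 0\<close> by the sum over \<open>0 < k \<le> g 0\<close>. The two sums differ by
  the terms for \<open>k = 0\<close> and \<open>k = g 0\<close>; they have the same integral, because the renewal
  set seen from \<open>g 0\<close> is the renewal set of the shifted gaps.\<close>

lemma palm_inverse_shift_1: "distr palm_inverse palm_inverse (\<lambda>\<eta> i. \<eta> (i + 1)) = palm_inverse"
proof (rule measure_eqI)
  fix A assume "A \<in> sets (distr palm_inverse palm_inverse (\<lambda>\<eta> i. \<eta> (i + 1)))"
  then have A: "A \<in> sets config_algebra" by (simp add: sets_palm_inverse)
  define T where "T = (\<lambda>(\<eta> :: int \<Rightarrow> bool) i. \<eta> (i + 1))"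
  have T: "T \<in> config_algebra \<rightarrow>\<^sub>M config_algebra" unfolding T_def by (rule measurable_shift)
  have TA: "T -` A \<in> sets config_algebra"
    using measurable_sets[OF T A] unfolding space_config Int_UNIV_right .
  define c where "c g k = (indicator A (\<lambda>i. renewal_set g (i + int k)) :: ennreal)" for g k
  have c_meas: "(\<lambda>g. c g k) \<in> borel_measurable gaps_measure" for k
    unfolding c_def by (rule measurable_hit[OF A])
  have c_gap_meas: "(\<lambda>g. c g (max 1 (g 0))) \<in> borel_measurable gaps_measure"
    by (rule measurable_compose_countable[where f = "\<lambda>k g. c g k", OF c_meas measurable_first_gap])
  have sum_meas: "(\<lambda>g. \<Sum>k<max 1 (g 0). c g k) \<in> borel_measurable gaps_measure"
    using c_meas by (rule measurable_sum_first_gap)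
  have sum_Suc_meas: "(\<lambda>g. \<Sum>k<max 1 (g 0). c g (Suc k)) \<in> borel_measurable gaps_measure"
    using c_meas by (rule measurable_sum_first_gap)
  have "(\<integral>\<^sup>+ g. c g (max 1 (g 0)) \<partial>gaps_measure) = (\<integral>\<^sup>+ g. c (\<lambda>i. g (i + 1)) 0 \<partial>gaps_measure)"
    by (rule nn_integral_cong) (simp add: c_def renewal_set_shift[abs_def])
  also have "\<dots> = (\<integral>\<^sup>+ g. c g 0 \<partial>distr gaps_measure gaps_measure (\<lambda>g i. g (i + 1)))"
  proof (rule nn_integral_distr[symmetric])
    show "(\<lambda>g i. g (i + 1)) \<in> gaps_measure \<rightarrow>\<^sub>M gaps_measure"
      unfolding gaps_measure_def by (rule measurable_PiM_single') auto
  qed (use c_meas in simp)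
  finally have swap: "(\<integral>\<^sup>+ g. c g (max 1 (g 0)) \<partial>gaps_measure) = (\<integral>\<^sup>+ g. c g 0 \<partial>gaps_measure)"
    by (simp only: distr_gaps_shift)
  have "(\<integral>\<^sup>+ g. (\<Sum>k<max 1 (g 0). c g k) \<partial>gaps_measure) + (\<integral>\<^sup>+ g. c g (max 1 (g 0)) \<partial>gaps_measure)
      = (\<integral>\<^sup>+ g. (\<Sum>k<max 1 (g 0). c g k) + c g (max 1 (g 0)) \<partial>gaps_measure)"
    by (rule nn_integral_add[OF sum_meas c_gap_meas, symmetric])
  also have "\<dots> = (\<integral>\<^sup>+ g. c g 0 + (\<Sum>k<max 1 (g 0). c g (Suc k)) \<partial>gaps_measure)"
    by (rule nn_integral_cong) (metis lessThan_Suc_eq_insert_0 sum.lessThan_Suc sum.lessThan_Suc_shift)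
  also have "\<dots> = (\<integral>\<^sup>+ g. c g 0 \<partial>gaps_measure) + (\<integral>\<^sup>+ g. (\<Sum>k<max 1 (g 0). c g (Suc k)) \<partial>gaps_measure)"
    by (rule nn_integral_add[OF c_meas sum_Suc_meas])
  finally have "(\<integral>\<^sup>+ g. c g 0 \<partial>gaps_measure) + (\<integral>\<^sup>+ g. (\<Sum>k<max 1 (g 0). c g k) \<partial>gaps_measure)
      = (\<integral>\<^sup>+ g. c g 0 \<partial>gaps_measure) + (\<integral>\<^sup>+ g. (\<Sum>k<max 1 (g 0). c g (Suc k)) \<partial>gaps_measure)"
    by (simp only: swap add.commute)
  moreover have "(\<integral>\<^sup>+ g. c g 0 \<partial>gaps_measure) \<noteq> \<infinity>"
  proof -
    have "(\<integral>\<^sup>+ g. c g 0 \<partial>gaps_measure) \<le> (\<integral>\<^sup>+ g. 1 \<partial>gaps_measure)"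
      by (intro nn_integral_mono) (auto simp: c_def indicator_def)
    also have "\<dots> = 1" using gaps.emeasure_space_1 by simp
    finally show ?thesis by (auto simp: top_unique)
  qed
  ultimately have "(\<integral>\<^sup>+ g. (\<Sum>k<max 1 (g 0). c g (Suc k)) \<partial>gaps_measure) = (\<integral>\<^sup>+ g. (\<Sum>k<max 1 (g 0). c g k) \<partial>gaps_measure)"
    by (simp add: ennreal_add_left_cancel)
  moreover have "indicator (T -` A) (\<lambda>i. renewal_set g (i + int k)) = c g (Suc k)" for g k
    by (simp add: c_def T_def indicator_def add.assoc add.commute[of 1])
  ultimately have "emeasure palm_inverse (T -` A) = emeasure palm_inverse A"
    unfolding emeasure_palm_inverse[OF A] emeasure_palm_inverse[OF TA] by (simp only: c_def)
  moreover have "emeasure (distr palm_inverse palm_inverse T) A = emeasure palm_inverse (T -` A)"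
  proof -
    have "T \<in> palm_inverse \<rightarrow>\<^sub>M palm_inverse"
      unfolding measurable_cong_sets[OF sets_palm_inverse sets_palm_inverse] by (rule T)
    then show ?thesis using A
      by (subst emeasure_distr) (simp_all add: sets_palm_inverse space_palm_inverse)
  qed
  ultimately show "emeasure (distr palm_inverse palm_inverse (\<lambda>\<eta> i. \<eta> (i + 1))) A = emeasure palm_inverse A"
    by (simp only: T_def)
qed simp

lemma palm_inverse_shift: "distr palm_inverse palm_inverse (\<lambda>\<eta> i. \<eta> (i + m)) = palm_inverse"
proof -
  have meas: "(\<lambda>\<eta> i. \<eta> (i + m)) \<in> palm_inverse \<rightarrow>\<^sub>M palm_inverse" for m
    unfolding measurable_cong_sets[OF sets_palm_inverse sets_palm_inverse] by (rule measurable_shift)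
  have comp: "distr (distr palm_inverse palm_inverse (\<lambda>\<eta> i. \<eta> (i + a))) palm_inverse (\<lambda>\<eta> i. \<eta> (i + b))
      = distr palm_inverse palm_inverse (\<lambda>\<eta> i. \<eta> (i + (a + b)))" for a b
    by (subst distr_distr[OF meas meas]) (simp add: o_def ac_simps)
  have id: "distr palm_inverse palm_inverse (\<lambda>\<eta> i. \<eta> (i + 0)) = palm_inverse"
    by (simp add: distr_id2)
  have minus_1: "distr palm_inverse palm_inverse (\<lambda>\<eta> i. \<eta> (i + - 1)) = palm_inverse"
    using comp[of 1 "- 1"] id by (simp only: palm_inverse_shift_1 add.right_inverse)
  show ?thesis
  proof (induction m rule: int_induct[where k = 0])
    case base
    show ?case by (rule id)
  next
    case (step1 m)
    then show ?case using comp[of m 1] by (simp only: palm_inverse_shift_1)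
  next
    case (step2 m)
    then show ?case using comp[of m "- 1"] minus_1 by simp
  qed
qed

lemma palm_inverse_nonempty: "AE \<eta> in palm_inverse. \<exists>i. \<eta> i"
proof -
  have E: "{\<eta>. \<exists>i. \<eta> i} \<in> sets config_algebra"
    by (rule config_event) measurable
  have "\<exists>i. renewal_set g (i + int k)" for g k
    by (rule exI[of _ "- int k"]) (simp add: renewal_set_0)
  then have ind: "indicator {\<eta>. \<exists>i. \<eta> i} (\<lambda>i. renewal_set g (i + int k)) = (1 :: ennreal)" for g k
    by simp
  have "emeasure palm_inverse {\<eta>. \<exists>i. \<eta> i} = emeasure palm_inverse UNIV"
    unfolding emeasure_palm_inverse[OF E] emeasure_palm_inverse[OF UNIV_config] ind by simp
  also have "\<dots> = 1"
    using prob_space.emeasure_space_1[OF prob_space_palm_inverse] by (simp only: space_palm_inverse)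
  finally have "prob_space.prob palm_inverse {\<eta>. \<exists>i. \<eta> i} = 1" by (simp add: measure_def)
  then have "AE \<eta> in palm_inverse. \<eta> \<in> {\<eta>. \<exists>i. \<eta> i}"
    by (rule prob_space.AE_prob_1[OF prob_space_palm_inverse])
  then show ?thesis by simp
qed

text \<open>Of the sites \<open>0 \<le> k < g 0\<close> only \<open>k = 0\<close> is a point, so conditioning removes both the averaging and the
  bias.\<close>

lemma palm_inverse_conditioned:
  "uniform_measure palm_inverse {\<eta>. \<eta> 0} = distr gaps_measure config_algebra renewal_set"
proof (rule measure_eqI)
  have E: "{\<eta>. \<eta> 0} \<in> sets config_algebra"
    by (rule config_event) measurable
  have first: "emeasure palm_inverse ({\<eta>. \<eta> 0} \<inter> A) = emeasure (distr gaps_measure config_algebra renewal_set) A / mean_gap"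
    if A: "A \<in> sets config_algebra" for A
  proof -
    have "(\<Sum>k<max 1 (g 0). indicator ({\<eta>. \<eta> 0} \<inter> A) (\<lambda>i. renewal_set g (i + int k))) = (indicator A (renewal_set g) :: ennreal)" for g
    proof -
      have no: "\<not> renewal_set g (int k)" if "0 < k" "k < max 1 (g 0)" for k
        using that renewal_point_Suc[of g 0] by (intro no_renewal_between[of g 0]) (auto simp: renewal_point_0)
      have "(\<Sum>k<max 1 (g 0). indicator ({\<eta>. \<eta> 0} \<inter> A) (\<lambda>i. renewal_set g (i + int k)))
          = (\<Sum>k\<in>{0}. indicator ({\<eta>. \<eta> 0} \<inter> A) (\<lambda>i. renewal_set g (i + int k)) :: ennreal)"
        by (rule sum.mono_neutral_right) (use no in \<open>auto simp: indicator_def\<close>)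
      then show ?thesis by (simp add: indicator_def renewal_set_0)
    qed
    then show ?thesis
      unfolding emeasure_palm_inverse[OF sets.Int[OF E A]] by (simp only: emeasure_first_renewal_set[OF A])
  qed
  have meas: "renewal_set \<in> gaps_measure \<rightarrow>\<^sub>M config_algebra"
    using measurable_gaps[OF measurable_shifted_renewal_set[of 0]] by simp
  have "emeasure (distr gaps_measure config_algebra renewal_set) UNIV = 1"
    using prob_space.emeasure_space_1[OF gaps.prob_space_distr[OF meas]] unfolding space_distr space_config .
  then have norm: "emeasure palm_inverse {\<eta>. \<eta> 0} = 1 / mean_gap"
    using first[OF UNIV_config] by simp
  fix A assume "A \<in> sets (uniform_measure palm_inverse {\<eta>. \<eta> 0})"
  then have A: "A \<in> sets config_algebra" by (simp add: sets_palm_inverse)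
  have cancel: "x / \<mu> / (1 / \<mu>) = x" if "\<mu> \<noteq> 0" "\<mu> \<noteq> \<infinity>" for x \<mu> :: ennreal
  proof -
    have "inverse \<mu> / inverse \<mu> = 1"
      using that by (intro ennreal_divide_self) (simp_all flip: less_top)
    then show ?thesis by (simp add: divide_ennreal_def mult.assoc)
  qed
  have "emeasure (uniform_measure palm_inverse {\<eta>. \<eta> 0}) A = emeasure palm_inverse ({\<eta>. \<eta> 0} \<inter> A) / emeasure palm_inverse {\<eta>. \<eta> 0}"
    using A E by (intro emeasure_uniform_measure) (simp_all add: sets_palm_inverse)
  then show "emeasure (uniform_measure palm_inverse {\<eta>. \<eta> 0}) A = emeasure (distr gaps_measure config_algebra renewal_set) A"
    unfolding first[OF A] norm cancel[OF mean_gap_bounds] .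
qed (simp add: sets_palm_inverse)

lemma stationary_renewal_law_palm_inverse:
  assumes support: "set_pmf G \<subseteq> {1..}"
  shows "stationary_renewal_law G palm_inverse"
proof -
  define R0 where "R0 = distr gaps_measure config_algebra renewal_set"
  have meas: "renewal_set \<in> gaps_measure \<rightarrow>\<^sub>M config_algebra"
    using measurable_gaps[OF measurable_shifted_renewal_set[of 0]] by simp
  interpret R0: prob_space R0 unfolding R0_def by (rule gaps.prob_space_distr[OF meas])
  have "AE n in measure_pmf G. 1 \<le> n" using support by (auto simp: AE_measure_pmf_iff)
  then have "AE g in gaps_measure. 1 \<le> g i" for i
    unfolding gaps_measure_def by (rule AE_PiM_component[rotated 2]) (auto intro: prob_space_measure_pmf)
  then have "AE g in gaps_measure. \<forall>i. 1 \<le> g i" unfolding AE_all_countable by blast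
  then have gaps_eq: "AE g in gaps_measure. \<forall>i. max 1 (g i) = g i" by eventually_elim (auto simp: max_def)
  have gap_meas: "gap k \<in> R0 \<rightarrow>\<^sub>M count_space UNIV" for k
    unfolding R0_def measurable_distr_eq1 by (rule measurable_gap)
  have max_meas: "(\<lambda>g. max 1 (g k)) \<in> gaps_measure \<rightarrow>\<^sub>M count_space UNIV" for k
    by (intro measurable_gaps measurable_compose[OF measurable_component_singleton[of k UNIV]]) auto
  have id_meas: "(\<lambda>g. g k) \<in> gaps_measure \<rightarrow>\<^sub>M count_space UNIV" for k
    by (intro measurable_gaps measurable_component_singleton) simp
  have law_gap: "distr R0 (count_space UNIV) (gap k) = measure_pmf G" for k
  proof -
    have "distr R0 (count_space UNIV) (gap k) = distr gaps_measure (count_space UNIV) (\<lambda>g. max 1 (g k))"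
      unfolding R0_def by (subst distr_distr[OF measurable_gap meas]) (simp add: o_def gap_renewal)
    also have "\<dots> = distr gaps_measure (count_space UNIV) (\<lambda>g. g k)"
      by (rule distr_cong_AE) (use gaps_eq max_meas id_meas in \<open>auto elim: eventually_mono\<close>)
    finally show ?thesis by (simp only: distr_gaps_component)
  qed
  have "R0.indep_vars (\<lambda>_. count_space UNIV) gap UNIV"
  proof (subst R0.indep_vars_iff_distr_eq_PiM)
    have gap_joint: "(\<lambda>\<eta>. \<lambda>i\<in>UNIV. gap i \<eta>) \<in> config_algebra \<rightarrow>\<^sub>M gap_algebra"
      by (rule measurable_restrict) (rule measurable_gap)
    have joint: "(\<lambda>g i. max 1 (g i)) \<in> gaps_measure \<rightarrow>\<^sub>M gap_algebra"
      by (rule measurable_PiM_single') (use max_meas in auto)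
    have "distr R0 gap_algebra (\<lambda>\<eta>. \<lambda>i\<in>UNIV. gap i \<eta>) = distr gaps_measure gap_algebra (\<lambda>g i. max 1 (g i))"
      unfolding R0_def by (subst distr_distr[OF gap_joint meas]) (simp add: o_def gap_renewal restrict_UNIV)
    also have "\<dots> = distr gaps_measure gap_algebra (\<lambda>g. g)"
    proof (rule distr_cong_AE)
      show "AE g in gaps_measure. (\<lambda>i. max 1 (g i)) = g" using gaps_eq by eventually_elim auto
      show "(\<lambda>g. g) \<in> gaps_measure \<rightarrow>\<^sub>M gap_algebra" by (rule measurable_gaps) simp
    qed (use joint in auto)
    also have "\<dots> = gaps_measure" by (rule distr_id2) (rule sets_gaps[symmetric])
    finally show "distr R0 gap_algebra (\<lambda>\<eta>. \<lambda>i\<in>UNIV. gap i \<eta>) = PiM UNIV (\<lambda>i. distr R0 (count_space UNIV) (gap i))"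
      by (simp only: law_gap gaps_measure_def)
  qed (use gap_meas in auto)
  then show ?thesis
    unfolding stationary_renewal_law_def Let_def palm_inverse_conditioned R0_def[symmetric]
    using prob_space_palm_inverse sets_palm_inverse palm_inverse_nonempty palm_inverse_shift law_gap by blast
qed

end

section \<open>A heavy-tailed gap distribution\<close>

text \<open>The gap is \<open>4^K\<close> with \<open>P(K = k) = (4/5) * (1/5)^k\<close>. The factor \<open>1/5\<close> is less than \<open>1/4\<close>, so that the
  mean is finite, and greater than \<open>1/8\<close>, so that \<open>2^k\<close> rows suffice for a run of length \<open>4^k\<close>.\<close>

definition heavy_gap :: "nat pmf" where
  "heavy_gap = map_pmf (\<lambda>k. 4 ^ k) (geometric_pmf (4 / 5))"

lemma set_pmf_heavy_gap: "set_pmf heavy_gap \<subseteq> {1..}"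
  by (auto simp: heavy_gap_def)

lemma integrable_heavy_gap: "integrable (measure_pmf heavy_gap) real"
proof -
  have "(\<integral>\<^sup>+ k. ennreal (norm (real (4 ^ k))) \<partial>measure_pmf (geometric_pmf (4 / 5)))
      = (\<integral>\<^sup>+ k. ennreal (4 / 5 * (4 / 5) ^ k) \<partial>count_space UNIV)"
    unfolding nn_integral_measure_pmf
  proof (rule nn_integral_cong)
    fix k :: nat
    have "pmf (geometric_pmf (4 / 5)) k * real (4 ^ k) = 4 / 5 * (4 / 5) ^ k"
      by (simp add: power_divide)
    then show "ennreal (pmf (geometric_pmf (4 / 5)) k) * ennreal (norm (real (4 ^ k))) = ennreal (4 / 5 * (4 / 5) ^ k)"
      by (simp flip: ennreal_mult)
  qed
  also have "\<dots> = ennreal (\<Sum>k. 4 / 5 * (4 / 5) ^ k)"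
    unfolding nn_integral_count_space_nat
    by (rule suminf_ennreal2) (auto intro: summable_mult summable_geometric)
  also have "\<dots> < \<infinity>" by simp
  finally have "integrable (measure_pmf (geometric_pmf (4 / 5))) (\<lambda>k. real (4 ^ k))"
    by (intro integrableI_bounded) auto
  then show ?thesis unfolding heavy_gap_def integrable_map_pmf_eq .
qed

lemma heavy_gap_tail: "4 / 25 * (1 / 5) ^ k \<le> measure (measure_pmf heavy_gap) {3 * 4 ^ k<..}"
proof -
  have "4 / 25 * (1 / 5) ^ k = measure (measure_pmf (geometric_pmf (4 / 5))) {Suc k}"
    by (simp add: measure_pmf_single)
  also have "\<dots> \<le> measure (measure_pmf (geometric_pmf (4 / 5))) ((\<lambda>k. (4::nat) ^ k) -` {3 * 4 ^ k<..})"
    by (rule measure_pmf.finite_measure_mono) auto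
  finally show ?thesis by (simp add: heavy_gap_def)
qed

theorem mainTheorem5:
  "\<exists>(G :: nat pmf) (\<delta> :: real).
     set_pmf G \<subseteq> {1..} \<and> integrable (measure_pmf G) real \<and>
     0 < \<delta> \<and> \<delta> < 1 / 2 \<and>
     (\<exists>R. stationary_renewal_law G R) \<and>
     (\<forall>R. stationary_renewal_law G R \<longrightarrow>
       (AE \<omega> in obstacle_field_law R.
          (\<nexists>w. nonneg_stationary_solution 0.9 \<delta> \<omega> w) \<and>
          (\<exists>u. evolution_solution 0.9 \<delta> \<omega> u) \<and>
          (\<forall>u. evolution_solution 0.9 \<delta> \<omega> u \<longrightarrow>
             (\<forall>i. filterlim (u i) at_top at_top) \<and>
             Limsup at_top (\<lambda>t. ereal (u 0 t / t)) = 0)))"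
\<comment> \<open>the hats are narrow enough for \<open>stationary_imp_obstacle_ray\<close>, as \<open>0.9 + 4 * \<delta> < 1\<close> and
    \<open>2 * (1 - 0.9) + 4 * \<delta> < 0.9\<close>\<close>
proof (intro exI[of _ heavy_gap] exI[of _ "1 / 100"] conjI allI impI)
  show "set_pmf heavy_gap \<subseteq> {1..}" by (rule set_pmf_heavy_gap)
  show "integrable (measure_pmf heavy_gap) real" by (rule integrable_heavy_gap)
  show "\<exists>R. stationary_renewal_law heavy_gap R"
    using stationary_renewal_law_palm_inverse[OF integrable_heavy_gap set_pmf_heavy_gap] by blast
  fix R assume "stationary_renewal_law heavy_gap R"
  then interpret stationary_renewal heavy_gap R by unfold_locales
  have "AE \<omega> in obstacle_field_law R. \<forall>N j m. \<not> obstacle_ray \<omega> N j m"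
    unfolding AE_all_countable using AE_no_obstacle_ray by blast
  moreover have "AE \<omega> in obstacle_field_law R.
      \<forall>\<^sub>F k in sequentially. \<exists>j<2^k. \<forall>i. \<bar>i\<bar> \<le> 4^k \<longrightarrow> \<not> \<omega> j i"
    by (rule AE_long_runs[of "4 / 25"]) (simp, rule heavy_gap_tail)
  ultimately show "AE \<omega> in obstacle_field_law R.
          (\<nexists>w. nonneg_stationary_solution 0.9 (1 / 100) \<omega> w) \<and>
          (\<exists>u. evolution_solution 0.9 (1 / 100) \<omega> u) \<and>
          (\<forall>u. evolution_solution 0.9 (1 / 100) \<omega> u \<longrightarrow>
             (\<forall>i. filterlim (u i) at_top at_top) \<and>
             Limsup at_top (\<lambda>t. ereal (u 0 t / t)) = 0)"
  proof eventually_elim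
    case (elim \<omega>)
    have none: "\<nexists>w. nonneg_stationary_solution 0.9 (1 / 100) \<omega> w"
    proof
      assume "\<exists>w. nonneg_stationary_solution 0.9 (1 / 100) \<omega> w"
      then obtain w where "nonneg_stationary_solution 0.9 (1 / 100) \<omega> w" by blast
      then have "\<exists>N j m. obstacle_ray \<omega> N j m" by (rule stationary_imp_obstacle_ray[rotated 3]) simp_all
      then show False using elim(1) by blast
    qed
    have top: "filterlim (u i) at_top at_top" if "evolution_solution 0.9 (1 / 100) \<omega> u" for u i
      by (rule evolution_solution_at_top[OF _ _ _ that none]) simp_all
    have "Limsup at_top (\<lambda>t. ereal (u 0 t / t)) = 0" if u: "evolution_solution 0.9 (1 / 100) \<omega> u" for u
    proof -
      have "((\<lambda>t. u 0 t / t) \<longlongrightarrow> 0) at_top"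
        by (rule sublinear_of_long_runs[OF _ _ _ _ u elim(2)]) simp_all
      then have "((\<lambda>t. ereal (u 0 t / t)) \<longlongrightarrow> ereal 0) at_top" by (rule tendsto_ereal)
      then show ?thesis using lim_imp_Limsup[of at_top "\<lambda>t. ereal (u 0 t / t)"] by (simp add: zero_ereal_def)
    qed
    moreover have "\<exists>u. evolution_solution 0.9 (1 / 100) \<omega> u"
      by (rule evolution_solution_exists) simp_all
    ultimately show ?case using none top by blast
  qed
qed simp_all

end
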